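(* Let $\theta,\chi\in C_c^\infty\big((-\frac12,\frac12)^2\big)$ be radially symmetric probability density functions, let $\kappa>0$, and for $\ell\in(0,1)$ let $\theta_\ell(x)=\ell^{-2}\theta(\ell^{-1}x)$, $\chi_\ell(x)=\ell^{-2}\chi(\ell^{-1}x)$, $\Gamma_\ell=2\sqrt\kappa\,\|K*\theta_\ell\|_{L^2}^{-1}$, let $\gamma_\ell>0$ be such that $\gamma_\ell\to0$ as $\ell\to0$, and put $$\sigma_H^\ell=\Gamma_\ell\,K*\theta_\ell,\qquad\sigma_3^\ell=\gamma_\ell\,G*\chi_\ell.$$ Let $Q_{H,3}^\ell$ and $Q_3^\ell$ be the corresponding covariance functions and $\|\cdot\|_M$ a norm on $2\times2$ matrices (see the context). Then: (1) If $\gamma_\ell=o(\Gamma_\ell)$ as $\ell\to0$, then the limit $A:=\lim_{\ell\to0}\nabla Q_{H,3}^\ell(0)$ is null, i.e. $A=0$. (2) If $q_0:=\lim_{\ell\to0}\frac{\gamma_\ell}{\Gamma_\ell}$ exists and $q_0\neq0$, then $$A=\lim_{\ell\to0}\nabla Q_{H,3}^\ell(0)=2\kappa q_0\begin{pmatrix}0&1\\-1&0\end{pmatrix}.$$ (3) If $\gamma_\ell=O(\Gamma_\ell)$ (i.e. there is a constant $C$ with $\gamma_\ell\le C\,\Gamma_\ell$ for all $\ell\in(0,1)$), then $\sup_{\ell\in(0,1)}\|\nabla^2Q_3^\ell(0)\|_M<+\infty$.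
   Context: $\mathbb T^2=\mathbb R^2/\mathbb Z^2$ is identified with $[-\frac12,\frac12]^2$ with periodic boundary conditions; functions compactly supported in $(-\frac12,\frac12)^2$ are regarded as functions on $\mathbb T^2$, and convolutions are on $\mathbb T^2$. $\nabla^\perp=(\partial_2,-\partial_1)$. $G$ is the Green function on $\mathbb T^2$, normalised so that $G(x)+\frac1{2\pi}\log|x|$ is smooth near $0$ (i.e. $-\Delta G=\delta_0-1$, with zero mean). $K$ is the Biot–Savart kernel on $\mathbb T^2$: for $f$ on $\mathbb T^2$, $K*f$ is the mean-zero divergence free vector field with $\nabla^\perp\cdot(K*f)=f-\int_{\mathbb T^2}f$. Covariances: $Q_{H,3}^\ell(a)=\int_{\mathbb T^2}\sigma_H^\ell(a-x)\,\sigma_3^\ell(x)\,dx\in\mathbb R^2$, with components $Q_{1,3}^\ell,Q_{2,3}^\ell$; $Q_3^\ell(a)=\int_{\mathbb T^2}\sigma_3^\ell(a-x)\sigma_3^\ell(x)\,dx$. $\nabla Q_{H,3}^\ell(0)$ is the $2\times2$ matrix with $(i,j)$ entry $\partial_jQ_{i,3}^\ell(0)$ and $\nabla^2Q_3^\ell(0)$ is the Hessian of $Q_3^\ell$ at $0$. *)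

theory Defs
  imports "HOL-Analysis.Analysis" "HOL-Library.Landau_Symbols"
begin

section \<open>Calculus in the plane\<close>

definition pderiv_dir :: "2 \<Rightarrow> (real^2 \<Rightarrow> 'b::real_normed_vector) \<Rightarrow> real^2 \<Rightarrow> 'b" where
  "pderiv_dir i f x = frechet_derivative f (at x) (axis i 1)"

text \<open>Meant for open \<open>S\<close>.\<close>

primrec Ck_on :: "nat \<Rightarrow> (real^2) set \<Rightarrow> (real^2 \<Rightarrow> 'b::real_normed_vector) \<Rightarrow> bool" where
  "Ck_on 0 S f \<longleftrightarrow> continuous_on S f"
| "Ck_on (Suc k) S f \<longleftrightarrow>
     (\<forall>x\<in>S. f differentiable (at x)) \<and> (\<forall>i. Ck_on k S (pderiv_dir i f))"

definition smooth_on :: "(real^2) set \<Rightarrow> (real^2 \<Rightarrow> 'b::real_normed_vector) \<Rightarrow> bool" where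
  "smooth_on S f \<longleftrightarrow> (\<forall>k. Ck_on k S f)"

definition laplacian :: "(real^2 \<Rightarrow> real) \<Rightarrow> real^2 \<Rightarrow> real" where
  "laplacian f x = (\<Sum>i\<in>UNIV. pderiv_dir i (pderiv_dir i f) x)"

definition divergence :: "(real^2 \<Rightarrow> real^2) \<Rightarrow> real^2 \<Rightarrow> real" where
  "divergence u x = (\<Sum>i\<in>UNIV. pderiv_dir i (\<lambda>y. u y $ i) x)"

text \<open>\<open>\<nabla>\<^sup>\<bottom> \<cdot> u\<close> with \<open>\<nabla>\<^sup>\<bottom> = (\<partial>\<^sub>2, -\<partial>\<^sub>1)\<close>; this is minus the usual scalar curl.\<close>

definition perp_div :: "(real^2 \<Rightarrow> real^2) \<Rightarrow> real^2 \<Rightarrow> real" where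
  "perp_div u x = pderiv_dir 2 (\<lambda>y. u y $ 1) x - pderiv_dir 1 (\<lambda>y. u y $ 2) x"

definition hessian :: "(real^2 \<Rightarrow> real) \<Rightarrow> real^2 \<Rightarrow> real^2^2" where
  "hessian f x = (\<chi> i j. pderiv_dir i (pderiv_dir j f) x)"

section \<open>The torus\<close>

text \<open>Functions on \<open>\<real>\<^sup>2 / \<int>\<^sup>2\<close> are \<open>\<int>\<^sup>2\<close>-periodic functions on the plane, integrated over the
  fundamental cell \<open>[-1/2, 1/2]\<^sup>2\<close>.\<close>

abbreviation cell :: "(real^2) set" where
  "cell \<equiv> cbox (vec (- 1/2)) (vec (1/2))"

abbreviation torus_integral :: "(real^2 \<Rightarrow> 'b::{banach,second_countable_topology}) \<Rightarrow> 'b" where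
  "torus_integral f \<equiv> set_lebesgue_integral lborel cell f"

definition periodic :: "(real^2 \<Rightarrow> 'b) \<Rightarrow> bool" where
  "periodic f \<longleftrightarrow> (\<forall>x i. f (x + axis i 1) = f x)"

text \<open>\<open>t - round t\<close> is the representative of \<open>t\<close> modulo 1 in \<open>[-1/2, 1/2)\<close>.\<close>

definition on_torus :: "(real^2 \<Rightarrow> 'b) \<Rightarrow> real^2 \<Rightarrow> 'b" where
  "on_torus f x = f (\<chi> i. x $ i - of_int (round (x $ i)))"

definition tconv ::
  "(real^2 \<Rightarrow> 'b::{banach,second_countable_topology}) \<Rightarrow> (real^2 \<Rightarrow> real) \<Rightarrow> real^2 \<Rightarrow> 'b" where
  "tconv f g a = torus_integral (\<lambda>x. g x *\<^sub>R f (a - x))"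

definition torus_L2norm :: "(real^2 \<Rightarrow> real^2) \<Rightarrow> real" where
  "torus_L2norm u = sqrt (torus_integral (\<lambda>x. (norm (u x))\<^sup>2))"

section \<open>Green function and Biot--Savart kernel\<close>

text \<open>The last conjunct is \<open>-\<Delta> G = \<delta>\<^sub>0 - 1\<close> in the sense of distributions. Zero mean and that
  equation determine \<open>G\<close> almost everywhere, and \<open>G\<close> is only used inside integrals.\<close>

definition green_function :: "(real^2 \<Rightarrow> real) \<Rightarrow> bool" where
  "green_function G \<longleftrightarrow>
     periodic G \<and> set_integrable lborel cell G \<and> torus_integral G = 0 \<and>
     (\<exists>r>0. \<exists>h. smooth_on (ball 0 r) h \<and>
        (\<forall>x\<in>ball 0 r - {0}. G x + ln (norm x) / (2 * pi) = h x)) \<and>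
     (\<forall>\<phi>. smooth_on UNIV \<phi> \<longrightarrow> periodic \<phi> \<longrightarrow>
        torus_integral (\<lambda>x. G x * (- laplacian \<phi> x)) = \<phi> 0 - torus_integral \<phi>)"

text \<open>Testing against smooth \<open>f\<close> determines \<open>K\<close> almost everywhere; with the sign convention of
  \<^const>\<open>perp_div\<close> one has \<open>K = -\<nabla>\<^sup>\<bottom> G = (-\<partial>\<^sub>2 G, \<partial>\<^sub>1 G)\<close>.\<close>

definition biot_savart_kernel :: "(real^2 \<Rightarrow> real^2) \<Rightarrow> bool" where
  "biot_savart_kernel K \<longleftrightarrow>
     periodic K \<and> set_integrable lborel cell K \<and>
     (\<forall>f. smooth_on UNIV f \<longrightarrow> periodic f \<longrightarrow>
        smooth_on UNIV (tconv K f) \<and>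
        torus_integral (tconv K f) = 0 \<and>
        (\<forall>x. divergence (tconv K f) x = 0) \<and>
        (\<forall>x. perp_div (tconv K f) x = f x - torus_integral f))"

section \<open>Mollifiers, noise coefficients and covariances\<close>

text \<open>Compactness of the support is automatic: it is closed and contained in a bounded box.\<close>

definition radial_mollifier :: "(real^2 \<Rightarrow> real) \<Rightarrow> bool" where
  "radial_mollifier \<theta> \<longleftrightarrow>
     smooth_on UNIV \<theta> \<and>
     closure {x. \<theta> x \<noteq> 0} \<subseteq> box (vec (- 1/2)) (vec (1/2)) \<and>
     (\<forall>x y. norm x = norm y \<longrightarrow> \<theta> x = \<theta> y) \<and>
     (\<forall>x. \<theta> x \<ge> 0) \<and> integral\<^sup>L lborel \<theta> = 1"

definition rescale :: "real \<Rightarrow> (real^2 \<Rightarrow> real) \<Rightarrow> real^2 \<Rightarrow> real" where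
  "rescale l \<theta> x = inverse (l\<^sup>2) * \<theta> (inverse l *\<^sub>R x)"

definition Gamma_coeff ::
  "(real^2 \<Rightarrow> real^2) \<Rightarrow> (real^2 \<Rightarrow> real) \<Rightarrow> real \<Rightarrow> real \<Rightarrow> real" where
  "Gamma_coeff K \<theta> \<kappa> l = 2 * sqrt \<kappa> * inverse (torus_L2norm (tconv K (on_torus (rescale l \<theta>))))"

definition sigma_H ::
  "(real^2 \<Rightarrow> real^2) \<Rightarrow> (real^2 \<Rightarrow> real) \<Rightarrow> real \<Rightarrow> real \<Rightarrow> real^2 \<Rightarrow> real^2" where
  "sigma_H K \<theta> \<kappa> l x = Gamma_coeff K \<theta> \<kappa> l *\<^sub>R tconv K (on_torus (rescale l \<theta>)) x"

definition sigma_3 ::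
  "(real^2 \<Rightarrow> real) \<Rightarrow> (real^2 \<Rightarrow> real) \<Rightarrow> (real \<Rightarrow> real) \<Rightarrow> real \<Rightarrow> real^2 \<Rightarrow> real" where
  "sigma_3 G chi \<gamma> l x = \<gamma> l * tconv G (on_torus (rescale l chi)) x"

definition Q_H3 ::
  "(real^2 \<Rightarrow> real) \<Rightarrow> (real^2 \<Rightarrow> real^2) \<Rightarrow> (real^2 \<Rightarrow> real) \<Rightarrow> (real^2 \<Rightarrow> real) \<Rightarrow> real \<Rightarrow>
   (real \<Rightarrow> real) \<Rightarrow> real \<Rightarrow> real^2 \<Rightarrow> real^2" where
  "Q_H3 G K \<theta> chi \<kappa> \<gamma> l = tconv (sigma_H K \<theta> \<kappa> l) (sigma_3 G chi \<gamma> l)"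

definition Q_3 ::
  "(real^2 \<Rightarrow> real) \<Rightarrow> (real^2 \<Rightarrow> real) \<Rightarrow> (real \<Rightarrow> real) \<Rightarrow> real \<Rightarrow> real^2 \<Rightarrow> real" where
  "Q_3 G chi \<gamma> l = tconv (sigma_3 G chi \<gamma> l) (sigma_3 G chi \<gamma> l)"

definition is_norm :: "('a::real_vector \<Rightarrow> real) \<Rightarrow> bool" where
  "is_norm N \<longleftrightarrow>
     (\<forall>A. N A \<ge> 0) \<and> (\<forall>A. N A = 0 \<longleftrightarrow> A = 0) \<and>
     (\<forall>c A. N (c *\<^sub>R A) = \<bar>c\<bar> * N A) \<and> (\<forall>A B. N (A + B) \<le> N A + N B)"

end

theory Submission
  imports Defs
begin

text \<open>Fix a scale \<open>l\<close>, let \<open>f\<close> and \<open>g\<close> be the periodised rescalings of \<open>\<theta>\<close> and \<open>chi\<close>, and put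
  \<open>\<phi> = G * f\<close>, \<open>\<psi> = G * g\<close>. Let \<open>E(g, f)\<close> be the integral of \<open>\<psi> f\<close>, the interaction energy of the two
  densities. Everything in the theorem can be computed in terms of such energies.

  The velocity is \<open>K * f = (- \<partial>\<^sub>2 \<phi>, \<partial>\<^sub>1 \<phi>)\<close>, so the gradient of the covariance of \<open>\<sigma>\<^sub>H\<close> and \<open>\<sigma>\<^sub>3\<close> at 0
  consists of the moments \<open>\<integral> \<psi>(x) \<partial>\<^sub>i \<partial>\<^sub>j \<phi>(- x) dx\<close>, multiplied by \<open>\<Gamma> \<gamma>\<close>. Both densities are
  invariant under the quarter turn, hence so are \<open>\<phi>\<close> and \<open>\<psi>\<close>, and the symmetric matrix of moments
  commutes with the quarter turn: it is a multiple of the identity. Its trace is \<open>- E(g, f)\<close> by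
  Poisson's equation. This gives
    \<open>\<nabla> Q\<^sub>H\<^sub>3(0) = (\<Gamma> \<gamma> E(g, f) / 2) J\<close> and \<open>\<nabla>\<^sup>2 Q\<^sub>3(0) = - (\<gamma>\<^sup>2 E(g, g) / 2) I\<close>
  with \<open>J\<close> the matrix of the statement (\<open>jacobian_Q_H3_energy\<close>, \<open>hessian_Q_3_energy\<close>). The same
  integration by parts shows that the squared norm of \<open>K * f\<close> is \<open>E(f, f)\<close>, that is
  \<open>\<Gamma>\<^sup>2 = 4 \<kappa> / E(f, f)\<close>. Consequently
    \<open>\<nabla> Q\<^sub>H\<^sub>3(0) = 2 \<kappa> (\<gamma> / \<Gamma>) (E(g, f) / E(f, f)) J\<close>.

  Because of the logarithmic singularity of \<open>G\<close>, every such energy is \<open>- ln l / (2 \<pi>) + O(1)\<close> as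
  \<open>l\<close> tends to 0 (\<open>energy_logarithmic\<close>), whatever the mollifiers are; so the ratio of energies tends
  to 1, which gives the first two claims. For the third, \<open>\<gamma> \<le> C \<Gamma>\<close> bounds the Hessian by
  \<open>2 \<kappa> C\<^sup>2 \<bar>E(g, g)\<bar> / E(f, f)\<close>. This is bounded near 0 by the same limit; away from 0 the numerator is
  bounded, and \<open>E(f, f)\<close> is bounded below because the support of \<open>\<theta>\<close> leaves a neighbourhood of the
  boundary of the cell empty at every scale (\<open>energy_bounded_below\<close>).

  The kernels \<open>G\<close> and \<open>K\<close> are only characterised by how they act on smooth functions. All
  pointwise information about \<open>\<phi>\<close> and \<open>K * f\<close>, their symmetry included, comes from Poisson's
  equation for \<open>\<phi>\<close>, the divergence and curl of \<open>K * f\<close>, and the fact that periodic harmonic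
  functions are constant.\<close>

section \<open>Continuously differentiable functions of the plane\<close>

lemma pderiv_dir_eq:
  assumes "(f has_derivative D) (at x)"
  shows "pderiv_dir i f x = D (axis i 1)"
  using frechet_derivative_at[OF assms] by (simp add: pderiv_dir_def)

lemma vec2_eq_sum: "(h::real^2) = h$1 *\<^sub>R axis 1 1 + h$2 *\<^sub>R axis 2 1"
  by (simp add: vec_eq_iff axis_def forall_2)

lemma has_derivative_pderivs:
  assumes "f differentiable (at x)"
  shows "(f has_derivative (\<lambda>h. h$1 *\<^sub>R pderiv_dir 1 f x + h$2 *\<^sub>R pderiv_dir 2 f x)) (at x)"
proof -
  have D: "(f has_derivative frechet_derivative f (at x)) (at x)"
    using assms by (simp add: frechet_derivative_works)
  have "frechet_derivative f (at x) h = h$1 *\<^sub>R pderiv_dir 1 f x + h$2 *\<^sub>R pderiv_dir 2 f x" for h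
  proof -
    have "linear (frechet_derivative f (at x))"
      using assms by (rule linear_frechet_derivative)
    then show ?thesis
      by (subst vec2_eq_sum[of h]) (simp add: linear_add linear_scale pderiv_dir_def)
  qed
  then have "frechet_derivative f (at x) = (\<lambda>h. h$1 *\<^sub>R pderiv_dir 1 f x + h$2 *\<^sub>R pderiv_dir 2 f x)"
    by blast
  with D show ?thesis by simp
qed

lemma Ck_on_SucD: "Ck_on (Suc k) UNIV f \<Longrightarrow> Ck_on k UNIV f"
proof (induction k arbitrary: f)
  case 0
  then show ?case
    by (auto simp: continuous_on_eq_continuous_within intro!: differentiable_imp_continuous_within)
next
  case (Suc k)
  then show ?case by (metis Ck_on.simps(2))
qed

lemma Ck_on_mono: "Ck_on m UNIV f \<Longrightarrow> k \<le> m \<Longrightarrow> Ck_on k UNIV f"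
  by (induction m) (auto simp: le_Suc_eq dest: Ck_on_SucD simp del: Ck_on.simps)

lemma Ck_on_continuous: "Ck_on k UNIV f \<Longrightarrow> continuous_on UNIV f"
  using Ck_on_mono[of k f 0] by simp

lemma smooth_on_differentiable: "smooth_on UNIV f \<Longrightarrow> f differentiable (at x)"
  by (metis UNIV_I Ck_on.simps(2) smooth_on_def)

lemma smooth_on_pderiv_dir: "smooth_on UNIV f \<Longrightarrow> smooth_on UNIV (pderiv_dir i f)"
  by (metis Ck_on.simps(2) smooth_on_def)

lemma smooth_on_continuous: "smooth_on UNIV f \<Longrightarrow> continuous_on UNIV f"
  by (metis Ck_on.simps(1) smooth_on_def)

text \<open>Translations, dilations and the reflections \<open>x \<mapsto> a - x\<close> of the convolution
  integrals are all instances.\<close>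

lemma pderiv_dir_affine:
  assumes "\<And>x. f differentiable (at x)"
  shows "((\<lambda>x. c *\<^sub>R f (b + s *\<^sub>R x)) has_derivative
           (\<lambda>h. c *\<^sub>R frechet_derivative f (at (b + s *\<^sub>R x)) (s *\<^sub>R h))) (at x)"
    and "pderiv_dir i (\<lambda>x. c *\<^sub>R f (b + s *\<^sub>R x)) = (\<lambda>x. (c * s) *\<^sub>R pderiv_dir i f (b + s *\<^sub>R x))"
proof -
  let ?D = "\<lambda>x. frechet_derivative f (at (b + s *\<^sub>R x))"
  have D: "((\<lambda>x. c *\<^sub>R f (b + s *\<^sub>R x)) has_derivative (\<lambda>h. c *\<^sub>R ?D x (s *\<^sub>R h))) (at x)" for x
  proof -
    have "(f has_derivative ?D x) (at (b + s *\<^sub>R x))"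
      using assms by (simp add: frechet_derivative_works[symmetric])
    then have "((\<lambda>x. f (b + s *\<^sub>R x)) has_derivative (\<lambda>h. ?D x (s *\<^sub>R h))) (at x)"
      by (rule has_derivative_compose[rotated]) (auto intro!: derivative_eq_intros)
    then show ?thesis by (rule has_derivative_scaleR_right)
  qed
  then show "((\<lambda>x. c *\<^sub>R f (b + s *\<^sub>R x)) has_derivative (\<lambda>h. c *\<^sub>R ?D x (s *\<^sub>R h))) (at x)" .
  show "pderiv_dir i (\<lambda>x. c *\<^sub>R f (b + s *\<^sub>R x)) = (\<lambda>x. (c * s) *\<^sub>R pderiv_dir i f (b + s *\<^sub>R x))"
  proof
    fix x
    have "linear (?D x)" using assms by (rule linear_frechet_derivative)
    then show "pderiv_dir i (\<lambda>x. c *\<^sub>R f (b + s *\<^sub>R x)) x = (c * s) *\<^sub>R pderiv_dir i f (b + s *\<^sub>R x)"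
      by (simp add: pderiv_dir_eq[OF D] linear_scale) (simp add: pderiv_dir_def)
  qed
qed

lemma Ck_on_affine: "Ck_on k UNIV f \<Longrightarrow> Ck_on k UNIV (\<lambda>x. c *\<^sub>R f (b + s *\<^sub>R x))"
proof (induction k arbitrary: f c)
  case 0
  then show ?case
    by (auto intro!: continuous_intros continuous_on_compose2[of UNIV f])
next
  case (Suc k)
  then have d: "\<And>x. f differentiable (at x)" by simp
  have "(\<lambda>x. c *\<^sub>R f (b + s *\<^sub>R x)) differentiable (at x)" for x
    using pderiv_dir_affine(1)[OF d] unfolding differentiable_def by blast
  with Suc show ?case by (simp add: pderiv_dir_affine(2)[OF d])
qed

lemma smooth_on_affine: "smooth_on UNIV f \<Longrightarrow> smooth_on UNIV (\<lambda>x. c *\<^sub>R f (b + s *\<^sub>R x))"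
  by (simp add: smooth_on_def Ck_on_affine)

lemma pderiv_dir_scaleR:
  "(\<And>x. f differentiable (at x)) \<Longrightarrow> pderiv_dir i (\<lambda>x. c *\<^sub>R f x) = (\<lambda>x. c *\<^sub>R pderiv_dir i f x)"
  using pderiv_dir_affine(2)[of f i c 0 1] by simp

lemma pderiv_dir_scaleR_eq:
  "f differentiable (at x) \<Longrightarrow> pderiv_dir i (\<lambda>x. c *\<^sub>R f x) x = c *\<^sub>R pderiv_dir i f x"
  by (subst pderiv_dir_eq[OF has_derivative_scaleR_right[of f "frechet_derivative f (at x)"]])
    (auto simp: frechet_derivative_works[symmetric] pderiv_dir_def)

lemma pderiv_dir_add:
  assumes "f differentiable (at x)" "g differentiable (at x)"
  shows "pderiv_dir i (\<lambda>x. f x + g x) x = pderiv_dir i f x + pderiv_dir i g x"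
  by (subst pderiv_dir_eq[OF has_derivative_add[of f "frechet_derivative f (at x)" _ g
          "frechet_derivative g (at x)"]])
    (use assms in \<open>auto simp: frechet_derivative_works[symmetric] pderiv_dir_def\<close>)

lemma Ck_on_add: "Ck_on k UNIV f \<Longrightarrow> Ck_on k UNIV g \<Longrightarrow> Ck_on k UNIV (\<lambda>x. f x + g x)"
proof (induction k arbitrary: f g)
  case 0
  then show ?case by (auto intro!: continuous_intros)
next
  case (Suc k)
  then have d: "\<And>x. f differentiable (at x)" "\<And>x. g differentiable (at x)" by auto
  have "pderiv_dir i (\<lambda>x. f x + g x) = (\<lambda>x. pderiv_dir i f x + pderiv_dir i g x)" for i
    using d by (auto simp: pderiv_dir_add)
  with Suc show ?case by simp
qed

lemma pderiv_dir_minus: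
  assumes "f differentiable (at x)"
  shows "pderiv_dir i (\<lambda>x. - f x) x = - pderiv_dir i f x"
  using pderiv_dir_scaleR_eq[OF assms, of i "-1"] by simp

lemma Ck_on_minus: "Ck_on k UNIV f \<Longrightarrow> Ck_on k UNIV (\<lambda>x. - f x)"
  using Ck_on_affine[of k f "-1" 0 1] by simp

lemma pderiv_dir_mult:
  fixes f g :: "real^2 \<Rightarrow> real"
  assumes "f differentiable (at x)" "g differentiable (at x)"
  shows "pderiv_dir i (\<lambda>x. f x * g x) x = f x * pderiv_dir i g x + pderiv_dir i f x * g x"
  by (subst pderiv_dir_eq[OF has_derivative_mult[of f "frechet_derivative f (at x)" _ _ g
          "frechet_derivative g (at x)"]])
    (use assms in \<open>auto simp: frechet_derivative_works[symmetric] pderiv_dir_def\<close>)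

lemma vec_nth_differentiable:
  assumes "u differentiable (at x)"
  shows "(\<lambda>y. (u y :: real^2) $ j) differentiable (at x)"
  using assms bounded_linear.has_derivative[OF bounded_linear_vec_nth]
  unfolding differentiable_def by blast

lemma pderiv_dir_vec_nth:
  assumes "u differentiable (at x)"
  shows "pderiv_dir i (\<lambda>y. (u y :: real^2) $ j) x = pderiv_dir i u x $ j"
  by (subst pderiv_dir_eq[OF bounded_linear.has_derivative[OF bounded_linear_vec_nth,
          of u "frechet_derivative u (at x)"]])
    (use assms in \<open>auto simp: frechet_derivative_works[symmetric] pderiv_dir_def\<close>)

lemma Ck_on_vec_nth: "Ck_on k UNIV u \<Longrightarrow> Ck_on k UNIV (\<lambda>y. (u y :: real^2) $ j)"
proof (induction k arbitrary: u)
  case 0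
  then show ?case by (auto intro!: continuous_intros)
next
  case (Suc k)
  then have "pderiv_dir i (\<lambda>y. u y $ j) = (\<lambda>y. pderiv_dir i u y $ j)" for i
    by (auto simp: pderiv_dir_vec_nth)
  with Suc show ?case by (simp add: vec_nth_differentiable)
qed

text \<open>The mean value theorem in direction \<open>i\<close> and then in direction \<open>j\<close>. The second difference
  on the left is symmetric in \<open>i\<close> and \<open>j\<close> while the derivative on the right is not, so letting
  \<open>h\<close> tend to 0 identifies the two mixed derivatives.\<close>

lemma second_difference_mean_value:
  fixes f :: "real^2 \<Rightarrow> real"
  assumes f: "Ck_on 2 UNIV f" and h: "h > 0"
  shows "\<exists>\<xi> \<eta>. 0 < \<xi> \<and> \<xi> < h \<and> 0 < \<eta> \<and> \<eta> < h \<and>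
    f (x + h *\<^sub>R axis i 1 + h *\<^sub>R axis j 1) - f (x + h *\<^sub>R axis i 1) - f (x + h *\<^sub>R axis j 1) + f x
      = h^2 * pderiv_dir j (pderiv_dir i f) (x + \<xi> *\<^sub>R axis i 1 + \<eta> *\<^sub>R axis j 1)"
proof -
  have line: "((\<lambda>s. F (y + s *\<^sub>R axis k 1)) has_real_derivative pderiv_dir k F (y + s *\<^sub>R axis k 1)) (at s)"
    if "\<And>x. F differentiable (at x)" for F :: "real^2 \<Rightarrow> real" and y k s
  proof -
    have "(F has_derivative frechet_derivative F (at (y + s *\<^sub>R axis k 1))) (at (y + s *\<^sub>R axis k 1))"
      using that by (simp add: frechet_derivative_works[symmetric])
    then have "((\<lambda>s. F (y + s *\<^sub>R axis k 1)) has_derivative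
        (\<lambda>t. frechet_derivative F (at (y + s *\<^sub>R axis k 1)) (t *\<^sub>R axis k 1))) (at s)"
      by (rule has_derivative_compose[rotated]) (auto intro!: derivative_eq_intros)
    moreover have "linear (frechet_derivative F (at (y + s *\<^sub>R axis k 1)))"
      using that by (rule linear_frechet_derivative)
    ultimately show ?thesis
      by (simp add: has_field_derivative_def linear_scale pderiv_dir_def mult_commute_abs)
  qed
  have d: "f differentiable (at x)" "pderiv_dir i f differentiable (at x)" for x
    using f by (auto simp: numeral_2_eq_2)
  let ?g = "\<lambda>s. f ((x + h *\<^sub>R axis j 1) + s *\<^sub>R axis i 1) - f (x + s *\<^sub>R axis i 1)"
  have "(?g has_real_derivative pderiv_dir i f ((x + h *\<^sub>R axis j 1) + s *\<^sub>R axis i 1)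
      - pderiv_dir i f (x + s *\<^sub>R axis i 1)) (at s)" for s
    by (intro DERIV_diff line d)
  from MVT2[OF h this] obtain \<xi> where \<xi>: "0 < \<xi>" "\<xi> < h"
    "?g h - ?g 0 = h * (pderiv_dir i f ((x + h *\<^sub>R axis j 1) + \<xi> *\<^sub>R axis i 1)
      - pderiv_dir i f (x + \<xi> *\<^sub>R axis i 1))"
    by auto
  from MVT2[OF h line[OF d(2), of "x + \<xi> *\<^sub>R axis i 1" j]] obtain \<eta> where "0 < \<eta>" "\<eta> < h"
    "pderiv_dir i f (x + \<xi> *\<^sub>R axis i 1 + h *\<^sub>R axis j 1) - pderiv_dir i f (x + \<xi> *\<^sub>R axis i 1)
      = h * pderiv_dir j (pderiv_dir i f) (x + \<xi> *\<^sub>R axis i 1 + \<eta> *\<^sub>R axis j 1)"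
    by auto
  with \<xi> show ?thesis
    by (intro exI[of _ \<xi>] exI[of _ \<eta>]) (simp add: power2_eq_square algebra_simps)
qed

lemma pderiv_dir_commute:
  fixes f :: "real^2 \<Rightarrow> real"
  assumes f: "Ck_on 2 UNIV f"
  shows "pderiv_dir i (pderiv_dir j f) x = pderiv_dir j (pderiv_dir i f) x"
proof (rule ccontr)
  let ?a = "pderiv_dir i (pderiv_dir j f)" and ?b = "pderiv_dir j (pderiv_dir i f)"
  assume "?a x \<noteq> ?b x"
  then have e: "dist (?a x) (?b x) / 2 > 0" (is "?e > 0") by simp
  have "isCont ?a x" "isCont ?b x"
    using f by (auto simp: numeral_2_eq_2 continuous_on_eq_continuous_at)
  with e obtain d1 d2 where d: "d1 > 0" "\<And>y. dist y x < d1 \<Longrightarrow> dist (?a y) (?a x) < ?e"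
    "d2 > 0" "\<And>y. dist y x < d2 \<Longrightarrow> dist (?b y) (?b x) < ?e"
    by (metis continuous_at_eps_delta dist_norm)
  define h where "h = min d1 d2 / 2"
  have h: "h > 0" "2 * h \<le> d1" "2 * h \<le> d2" using d by (auto simp: h_def)
  have near: "dist (x + \<xi> *\<^sub>R axis k 1 + \<eta> *\<^sub>R axis m 1) x < 2 * h"
    if "0 < \<xi>" "\<xi> < h" "0 < \<eta>" "\<eta> < h" for \<xi> \<eta> and k m :: 2
  proof -
    have "norm (\<xi> *\<^sub>R axis k 1 + \<eta> *\<^sub>R axis m 1 :: real^2) \<le> \<xi> + \<eta>"
      using that by (intro norm_triangle_le) simp
    with that show ?thesis by (simp add: dist_norm add.assoc)
  qed
  obtain \<xi> \<eta> where 1: "0 < \<xi>" "\<xi> < h" "0 < \<eta>" "\<eta> < h"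
    "f (x + h *\<^sub>R axis i 1 + h *\<^sub>R axis j 1) - f (x + h *\<^sub>R axis i 1) - f (x + h *\<^sub>R axis j 1) + f x
      = h^2 * ?b (x + \<xi> *\<^sub>R axis i 1 + \<eta> *\<^sub>R axis j 1)"
    using second_difference_mean_value[OF f h(1)] by blast
  obtain \<xi>' \<eta>' where 2: "0 < \<xi>'" "\<xi>' < h" "0 < \<eta>'" "\<eta>' < h"
    "f (x + h *\<^sub>R axis j 1 + h *\<^sub>R axis i 1) - f (x + h *\<^sub>R axis j 1) - f (x + h *\<^sub>R axis i 1) + f x
      = h^2 * ?a (x + \<xi>' *\<^sub>R axis j 1 + \<eta>' *\<^sub>R axis i 1)"
    using second_difference_mean_value[OF f h(1)] by blast
  have "h^2 * ?a (x + \<xi>' *\<^sub>R axis j 1 + \<eta>' *\<^sub>R axis i 1) = h^2 * ?b (x + \<xi> *\<^sub>R axis i 1 + \<eta> *\<^sub>R axis j 1)"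
    unfolding 1(5)[symmetric] 2(5)[symmetric] by (simp add: algebra_simps)
  then have "?a (x + \<xi>' *\<^sub>R axis j 1 + \<eta>' *\<^sub>R axis i 1) = ?b (x + \<xi> *\<^sub>R axis i 1 + \<eta> *\<^sub>R axis j 1)"
    using h by simp
  moreover have "dist (?a (x + \<xi>' *\<^sub>R axis j 1 + \<eta>' *\<^sub>R axis i 1)) (?a x) < ?e"
    using near[OF 2(1-4)] h by (intro d(2)) (smt (verit))
  moreover have "dist (?b (x + \<xi> *\<^sub>R axis i 1 + \<eta> *\<^sub>R axis j 1)) (?b x) < ?e"
    using near[OF 1(1-4)] h by (intro d(4)) (smt (verit))
  ultimately show False
    by (smt (verit) dist_commute dist_triangle field_sum_of_halves)
qed

section \<open>Integration over the torus\<close>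

text \<open>The simplifier turns the cell into the form of the second statement, since it moves the
  minus sign out of the fraction.\<close>

lemma cell_iff:
  "x \<in> cell \<longleftrightarrow> (\<forall>i. \<bar>x$i\<bar> \<le> 1/2)"
  "x \<in> cbox (vec (- (1/2))) (vec (1/2)) \<longleftrightarrow> (\<forall>i. \<bar>x$i\<bar> \<le> 1/2)"
  for x :: "real^2"
proof -
  have "x \<in> cell \<longleftrightarrow> (\<forall>i. - 1/2 \<le> x$i \<and> x$i \<le> 1/2)"
    unfolding mem_box_cart vec_def by simp
  then show "x \<in> cell \<longleftrightarrow> (\<forall>i. \<bar>x$i\<bar> \<le> 1/2)"
    by (simp add: forall_2 abs_le_iff) linarith
  then show "x \<in> cbox (vec (- (1/2))) (vec (1/2)) \<longleftrightarrow> (\<forall>i. \<bar>x$i\<bar> \<le> 1/2)"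
    by (simp only: minus_divide_left)
qed

lemma periodic_int_shift:
  assumes "periodic f"
  shows "f (x + of_int n *\<^sub>R axis i 1) = f x"
proof -
  have pos: "f (x + of_nat m *\<^sub>R axis i 1) = f x" for m x
  proof (induction m arbitrary: x)
    case (Suc m)
    have "f (x + of_nat (Suc m) *\<^sub>R axis i 1) = f ((x + of_nat m *\<^sub>R axis i 1) + axis i 1)"
      by (simp add: algebra_simps)
    also have "\<dots> = f x" using assms Suc by (simp only: periodic_def)
    finally show ?case .
  qed simp
  show ?thesis
  proof (cases "n \<ge> 0")
    case True
    then show ?thesis using pos[of x "nat n"] by simp
  next
    case False
    then show ?thesis using pos[of "x + of_int n *\<^sub>R axis i 1" "nat (-n)"] by simp
  qed
qed

lemma periodic_Ints_shift:
  assumes "periodic f" "\<forall>i. k$i \<in> \<int>"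
  shows "f (x + k) = f x"
proof -
  obtain m n where "k$1 = of_int m" "k$2 = of_int n"
    using assms(2) by (metis Ints_cases)
  then have "x + k = x + of_int m *\<^sub>R axis 1 1 + of_int n *\<^sub>R axis 2 1"
    by (subst vec2_eq_sum[of k]) (simp add: add.assoc)
  then show ?thesis by (simp only: periodic_int_shift[OF assms(1)])
qed

lemma exists_cell_representative: "\<exists>k::real^2. (\<forall>i. k$i \<in> \<int>) \<and> x - k \<in> cell"
proof (intro exI conjI allI)
  let ?k = "(\<chi> i. of_int (round (x$i))) :: real^2"
  show "?k$i \<in> \<int>" for i by simp
  show "x - ?k \<in> cell"
    unfolding cell_iff using of_int_round_abs_le[of "x$i" for i] by (simp add: abs_minus_commute)
qed

lemma periodic_eqI:
  assumes "periodic f" "periodic g" "\<And>x. x \<in> cell \<Longrightarrow> f x = g x"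
  shows "f x = g x"
proof -
  obtain k where k: "\<forall>i. k$i \<in> \<int>" "x - k \<in> cell" using exists_cell_representative[of x] by blast
  have "f (x - k + k) = g (x - k + k)"
    using assms k by (metis periodic_Ints_shift)
  then show ?thesis by simp
qed

lemma periodic_bounded:
  assumes "periodic f" "continuous_on UNIV f"
  obtains B where "B \<ge> 0" "\<And>x. norm (f x) \<le> B"
proof -
  have "compact (f ` cell)"
    by (intro compact_continuous_image continuous_on_subset[OF assms(2)]) auto
  then obtain B where B: "\<And>x. x \<in> cell \<Longrightarrow> norm (f x) \<le> B"
    by (meson compact_imp_bounded bounded_iff imageI)
  have "norm (f x) \<le> B" for x
  proof -
    obtain k where k: "\<forall>i. k$i \<in> \<int>" "x - k \<in> cell" using exists_cell_representative[of x] by blast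
    have "f (x - k + k) = f (x - k)" by (rule periodic_Ints_shift[OF assms(1) k(1)])
    with B[OF k(2)] show ?thesis by simp
  qed
  moreover have "B \<ge> 0" by (rule order_trans[OF norm_ge_zero B[of 0]]) (simp add: cell_iff)
  ultimately show ?thesis using that by blast
qed

lemma integrable_translate:
  fixes f :: "real^2 \<Rightarrow> 'b::{banach,second_countable_topology}"
  assumes "integrable lborel f"
  shows "integrable lborel (\<lambda>x. f (x + c))" "(LINT x|lborel. f (x + c)) = integral\<^sup>L lborel f"
proof -
  have [measurable]: "f \<in> borel_measurable borel" using assms by auto
  have "integrable (distr lborel borel ((+) c)) f" using assms by (simp add: lborel_distr_plus)
  then show "integrable lborel (\<lambda>x. f (x + c))"
    by (subst (asm) integrable_distr_eq) (auto simp: add.commute)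
  have "integral\<^sup>L (distr lborel borel ((+) c)) f = (LINT x|lborel. f (c + x))"
    by (rule integral_distr) auto
  then show "(LINT x|lborel. f (x + c)) = integral\<^sup>L lborel f"
    by (simp add: lborel_distr_plus add.commute)
qed

lemma AE_vec_nth_neq: "AE x in lborel. (x::real^2)$i \<noteq> c"
  using AE_lborel_inner_neq[of "axis i 1 :: real^2" c]
  by (simp add: inner_axis axis_in_Basis_iff)

lemma periodic_translate: "periodic F \<Longrightarrow> periodic (\<lambda>x. F (x + a))"
  unfolding periodic_def by (metis (no_types, lifting) add.assoc add.commute)

text \<open>The translated cell sticks out of the cell on one side; moving the overhang back by one
  period fills the gap on the other side, up to sets contained in hyperplanes.\<close>

lemma torus_shift_aux:
  fixes F :: "real^2 \<Rightarrow> 'b::{banach,second_countable_topology}"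
  assumes per: "periodic F" and int: "set_integrable lborel cell F" and t: "0 \<le> t" "t \<le> 1"
  shows "set_integrable lborel cell (\<lambda>x. F (x + t *\<^sub>R axis i 1)) \<and>
    torus_integral (\<lambda>x. F (x + t *\<^sub>R axis i 1)) = torus_integral F"
proof -
  let ?e = "axis i 1 :: real^2"
  define A where "A = {x \<in> cell. x$i < 1/2 - t}"
  define B where "B = {x \<in> cell. x$i \<ge> 1/2 - t}"
  define A' where "A' = {x \<in> cell. x$i \<ge> -1/2 + t \<and> x$i < 1/2}"
  define B' where "B' = {x \<in> cell. x$i \<le> -1/2 + t}"
  have [measurable]: "A' \<in> sets borel" "B' \<in> sets borel" unfolding A'_def B'_def by measurable
  have A: "x \<in> A \<longleftrightarrow> x + t *\<^sub>R ?e \<in> A'" for x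
  proof -
    consider "i = 1" | "i = 2" using exhaust_2[of i] by blast
    then show ?thesis
    proof cases
      case 1
      then have "(x + t *\<^sub>R ?e)$1 = x$1 + t" "(x + t *\<^sub>R ?e)$2 = x$2"
        by (simp_all add: axis_def)
      then show ?thesis
        using t 1 unfolding A_def A'_def cell_iff mem_Collect_eq forall_2 abs_le_iff by auto
    next
      case 2
      then have "(x + t *\<^sub>R ?e)$2 = x$2 + t" "(x + t *\<^sub>R ?e)$1 = x$1"
        by (simp_all add: axis_def)
      then show ?thesis
        using t 2 unfolding A_def A'_def cell_iff mem_Collect_eq forall_2 abs_le_iff by auto
    qed
  qed
  have B: "x \<in> B \<longleftrightarrow> x + (t - 1) *\<^sub>R ?e \<in> B'" for x
  proof -
    consider "i = 1" | "i = 2" using exhaust_2[of i] by blast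
    then show ?thesis
    proof cases
      case 1
      then have "(x + (t - 1) *\<^sub>R ?e)$1 = x$1 + (t - 1)" "(x + (t - 1) *\<^sub>R ?e)$2 = x$2"
        by (simp_all add: axis_def)
      then show ?thesis
        using t 1 unfolding B_def B'_def cell_iff mem_Collect_eq forall_2 abs_le_iff by auto
    next
      case 2
      then have "(x + (t - 1) *\<^sub>R ?e)$2 = x$2 + (t - 1)" "(x + (t - 1) *\<^sub>R ?e)$1 = x$1"
        by (simp_all add: axis_def)
      then show ?thesis
        using t 2 unfolding B_def B'_def cell_iff mem_Collect_eq forall_2 abs_le_iff by auto
    qed
  qed
  have F1: "F (x + t *\<^sub>R ?e) = F (x + (t - 1) *\<^sub>R ?e)" for x
  proof -
    have "x + t *\<^sub>R ?e = (x + (t - 1) *\<^sub>R ?e) + ?e" by (simp add: algebra_simps)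
    moreover have "F ((x + (t - 1) *\<^sub>R ?e) + ?e) = F (x + (t - 1) *\<^sub>R ?e)"
      using per unfolding periodic_def by blast
    ultimately show ?thesis by (rule back_subst[of "\<lambda>z. F z = F (x + (t - 1) *\<^sub>R ?e)", rotated, OF sym])
  qed
  have eq: "indicator cell x *\<^sub>R F (x + t *\<^sub>R ?e) =
    indicator A' (x + t *\<^sub>R ?e) *\<^sub>R F (x + t *\<^sub>R ?e) +
    indicator B' (x + (t - 1) *\<^sub>R ?e) *\<^sub>R F (x + (t - 1) *\<^sub>R ?e)" for x
  proof -
    have "indicator A' (x + t *\<^sub>R ?e) = (indicator A x :: real)"
      "indicator B' (x + (t - 1) *\<^sub>R ?e) = (indicator B x :: real)"
      using A[of x] B[of x] by (auto simp: indicator_def)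
    moreover have "(indicator cell x :: real) = indicator A x + indicator B x"
      by (auto simp: A_def B_def indicator_def)
    ultimately show ?thesis by (simp only: F1[of x] scaleR_add_left)
  qed
  have iA: "integrable lborel (\<lambda>x. indicator A' x *\<^sub>R F x)"
    using set_integrable_subset[OF int, of A'] by (auto simp: A'_def set_integrable_def)
  have iB: "integrable lborel (\<lambda>x. indicator B' x *\<^sub>R F x)"
    using set_integrable_subset[OF int, of B'] by (auto simp: B'_def set_integrable_def)
  note A2 = integrable_translate[OF iA, of "t *\<^sub>R ?e"]
  note B2 = integrable_translate[OF iB, of "(t-1) *\<^sub>R ?e"]
  have "torus_integral F = (LINT x|lborel. indicator A' x *\<^sub>R F x + indicator B' x *\<^sub>R F x)"
  proof -
    have "AE x in lborel. indicator cell x *\<^sub>R F x = indicator A' x *\<^sub>R F x + indicator B' x *\<^sub>R F x"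
      using AE_vec_nth_neq[of i "-1/2 + t"] AE_vec_nth_neq[of i "1/2"]
    proof eventually_elim
      case (elim x)
      have "x \<in> cell \<Longrightarrow> x$i \<le> 1/2" unfolding cell_iff by (metis abs_le_D1)
      with elim have "(indicator cell x :: real) = indicator A' x + indicator B' x"
        by (auto simp: A'_def B'_def indicator_def)
      then show ?case by (simp add: scaleR_add_left[symmetric])
    qed
    then show ?thesis unfolding set_lebesgue_integral_def
      using int iA iB by (intro integral_cong_AE) (auto simp: set_integrable_def)
  qed
  also have "\<dots> = integral\<^sup>L lborel (\<lambda>x. indicator A' x *\<^sub>R F x) + integral\<^sup>L lborel (\<lambda>x. indicator B' x *\<^sub>R F x)"
    by (rule Bochner_Integration.integral_add[OF iA iB])
  finally have "torus_integral (\<lambda>x. F (x + t *\<^sub>R axis i 1)) = torus_integral F"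
    unfolding set_lebesgue_integral_def eq
    by (simp only: Bochner_Integration.integral_add[OF A2(1) B2(1)] A2(2) B2(2))
  moreover have "set_integrable lborel cell (\<lambda>x. F (x + t *\<^sub>R axis i 1))"
    unfolding set_integrable_def eq by (rule Bochner_Integration.integrable_add[OF A2(1) B2(1)])
  ultimately show ?thesis by blast
qed

lemma torus_shift:
  fixes F :: "real^2 \<Rightarrow> 'b::{banach,second_countable_topology}"
  assumes per: "periodic F" and int: "set_integrable lborel cell F"
  shows "set_integrable lborel cell (\<lambda>x. F (x + a))"
    and "torus_integral (\<lambda>x. F (x + a)) = torus_integral F"
proof -
  have one: "set_integrable lborel cell (\<lambda>x. H (x + s *\<^sub>R axis i 1)) \<and>
    torus_integral (\<lambda>x. H (x + s *\<^sub>R axis i 1)) = torus_integral H"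
    if H: "periodic H" "set_integrable lborel cell H" for H :: "real^2 \<Rightarrow> 'b" and s i
  proof -
    have "x + s *\<^sub>R axis i 1 = (x + frac s *\<^sub>R axis i 1) + of_int \<lfloor>s\<rfloor> *\<^sub>R axis i 1" for x :: "real^2"
      by (simp add: frac_def algebra_simps)
    then have "H (x + s *\<^sub>R axis i 1) = H (x + frac s *\<^sub>R axis i 1)" for x
      using periodic_int_shift[OF H(1)] by metis
    then show ?thesis
      using torus_shift_aux[OF H, of "frac s" i] by (simp add: frac_lt_1 less_imp_le)
  qed
  have a: "x + a = (x + a$2 *\<^sub>R axis 2 1) + a$1 *\<^sub>R axis 1 1" for x
    by (subst vec2_eq_sum[of a]) (simp add: algebra_simps)
  note o1 = one[OF assms, of "a$1" 1]
  note o2 = one[OF periodic_translate[OF per, of "a$1 *\<^sub>R axis 1 1"], of "a$2" 2]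
  show "set_integrable lborel cell (\<lambda>x. F (x + a))" "torus_integral (\<lambda>x. F (x + a)) = torus_integral F"
    using o1 o2 by (simp_all add: a)
qed

text \<open>The symmetry of the torus on which the isotropy of the covariances rests. Its square is
  \<open>x \<mapsto> - x\<close>, so a function that is invariant under it is also even.\<close>

definition rot :: "real^2 \<Rightarrow> real^2" where
  "rot x = vector [- (x$2), x$1]"

lemma rot_nth [simp]: "rot x $ 1 = - (x$2)" "rot x $ 2 = x$1"
  by (simp_all add: rot_def vector_2)

lemma rot_rot [simp]: "rot (rot x) = - x"
  by (simp add: vec_eq_iff forall_2)

lemma linear_rot: "linear rot"
  by (rule linearI) (simp_all add: vec_eq_iff forall_2)

lemma bounded_linear_rot: "bounded_linear rot"
  using linear_rot by (simp add: linear_conv_bounded_linear)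

lemma norm_rot [simp]: "norm (rot x) = norm x"
  by (simp add: norm_vec_def L2_set_def sum_2 add.commute)

lemma rot_cell [simp]: "rot x \<in> cell \<longleftrightarrow> x \<in> cell"
  by (auto simp: cell_iff forall_2)

lemma rot_measurable [measurable]: "rot \<in> borel_measurable borel"
  by (intro borel_measurable_continuous_onI linear_continuous_on bounded_linear_rot)

lemma lborel_distr_rot: "distr lborel borel rot = lborel"
proof (rule lborel_eqI[symmetric])
  fix l u :: "real^2"
  assume le: "\<And>b. b \<in> Basis \<Longrightarrow> l \<bullet> b \<le> u \<bullet> b"
  have le': "l$i \<le> u$i" for i
    using le[of "axis i 1"] by (simp add: inner_axis axis_in_Basis_iff)
  have bas: "(Basis :: (real^2) set) = {axis 1 1, axis 2 1}"
    by (auto simp: Basis_vec_def UNIV_2)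
  have pr: "(\<Prod>b\<in>Basis. v \<bullet> b) = v$1 * v$2" for v :: "real^2"
  proof -
    have "axis 1 1 \<noteq> (axis 2 1 :: real^2)" by (simp add: axis_eq_axis)
    then show ?thesis unfolding bas by (simp add: inner_axis)
  qed
  have "rot -` box l u = box (vector [l$2, - (u$1)]) (vector [u$2, - (l$1)])"
    by (auto simp: mem_box_cart forall_2 vector_2)
  then have "emeasure (distr lborel borel rot) (box l u)
      = emeasure lborel (box (vector [l$2, - (u$1)]) (vector [u$2, - (l$1)]) :: (real^2) set)"
    by (simp add: emeasure_distr)
  also have "\<dots> = (\<Prod>b\<in>Basis. (vector [u$2, - (l$1)] - vector [l$2, - (u$1)] :: real^2) \<bullet> b)"
    using le' by (intro emeasure_lborel_box)
      (auto simp: bas inner_axis vector_2)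
  also have "\<dots> = (\<Prod>b\<in>Basis. (u - l) \<bullet> b)"
    by (simp add: pr vector_2 mult.commute)
  finally show "emeasure (distr lborel borel rot) (box l u) = (\<Prod>b\<in>Basis. (u - l) \<bullet> b)" .
qed simp

lemma torus_rot:
  fixes F :: "real^2 \<Rightarrow> 'b::{banach,second_countable_topology}"
  assumes "set_integrable lborel cell F"
  shows "set_integrable lborel cell (\<lambda>x. F (rot x))" "torus_integral (\<lambda>x. F (rot x)) = torus_integral F"
proof -
  let ?F = "\<lambda>x. indicator cell x *\<^sub>R F x"
  have i: "integrable lborel ?F" using assms by (simp add: set_integrable_def)
  then have m: "?F \<in> borel_measurable borel" using borel_measurable_integrable by fastforce
  have r: "rot \<in> lborel \<rightarrow>\<^sub>M borel" by simp
  have F: "?F (rot x) = indicator cell x *\<^sub>R F (rot x)" for x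
    by (simp only: indicator_def rot_cell)
  have "integrable (distr lborel borel rot) ?F" using i by (simp add: lborel_distr_rot)
  then have "integrable lborel (\<lambda>x. ?F (rot x))"
    by (rule iffD1[OF integrable_distr_eq[OF r m]])
  then show "set_integrable lborel cell (\<lambda>x. F (rot x))" by (simp only: set_integrable_def F)
  have "integral\<^sup>L (distr lborel borel rot) ?F = (LINT x|lborel. ?F (rot x))"
    by (rule integral_distr[OF r m])
  then show "torus_integral (\<lambda>x. F (rot x)) = torus_integral F"
    by (simp only: set_lebesgue_integral_def F lborel_distr_rot)
qed

lemma torus_uminus:
  fixes F :: "real^2 \<Rightarrow> 'b::{banach,second_countable_topology}"
  assumes "set_integrable lborel cell F"
  shows "set_integrable lborel cell (\<lambda>x. F (- x))" "torus_integral (\<lambda>x. F (- x)) = torus_integral F"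
  using torus_rot[OF torus_rot(1)[OF assms]] torus_rot(2)[OF assms] by simp_all

lemma torus_reflect:
  fixes F :: "real^2 \<Rightarrow> 'b::{banach,second_countable_topology}"
  assumes "periodic F" "set_integrable lborel cell F"
  shows "set_integrable lborel cell (\<lambda>x. F (a - x))" "torus_integral (\<lambda>x. F (a - x)) = torus_integral F"
  using torus_uminus[OF torus_shift(1)[OF assms, of a]] torus_shift(2)[OF assms, of a]
  by simp_all

lemma continuous_torus_integrable:
  fixes f :: "real^2 \<Rightarrow> 'b::{banach,second_countable_topology}"
  assumes "continuous_on UNIV f"
  shows "set_integrable lborel cell f"
  unfolding set_integrable_def
  using assms by (intro borel_integrable_compact) (auto intro: continuous_on_subset)

lemma torus_integral_const: "torus_integral (\<lambda>x. c :: real) = c"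
proof -
  have "measure lborel cell = 1"
    by (subst content_cbox_cart) (auto simp: cell_iff interval_cbox_cart)
  then show ?thesis by (simp add: set_lebesgue_integral_def)
qed

lemma torus_integral_mono:
  fixes f g :: "real^2 \<Rightarrow> real"
  assumes "set_integrable lborel cell f" "set_integrable lborel cell g" "\<And>x. x \<in> cell \<Longrightarrow> f x \<le> g x"
  shows "torus_integral f \<le> torus_integral g"
  using assms by (intro set_integral_mono) auto

text \<open>The kernels are merely integrable, so every estimate of a convolution puts the
  supremum on the other factor.\<close>

lemma set_integrable_bounded_scaleR:
  fixes g :: "real^2 \<Rightarrow> 'b::{banach,second_countable_topology}"
  assumes F: "set_integrable lborel cell F" and g: "continuous_on UNIV g" "\<And>x. norm (g x) \<le> B"
  shows "set_integrable lborel cell (\<lambda>x. F x *\<^sub>R g x)"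
    and "norm (torus_integral (\<lambda>x. F x *\<^sub>R g x)) \<le> torus_integral (\<lambda>x. \<bar>F x\<bar>) * B"
proof -
  have F': "integrable lborel (\<lambda>x. indicator cell x *\<^sub>R F x)"
    using F by (simp add: set_integrable_def)
  have [measurable]: "g \<in> borel_measurable borel"
    using g(1) by (rule borel_measurable_continuous_onI)
  have [measurable]: "(\<lambda>x. indicator cell x *\<^sub>R F x) \<in> borel_measurable borel" using F' by auto
  have m: "(\<lambda>x. (indicator cell x *\<^sub>R F x) *\<^sub>R g x) \<in> borel_measurable lborel" by measurable
  have F2: "integrable lborel (\<lambda>x. B * norm (indicator cell x *\<^sub>R F x))"
    using F' by (intro integrable_mult_right integrable_norm)
  have b: "norm ((indicator cell x *\<^sub>R F x) *\<^sub>R g x) \<le> B * norm (indicator cell x *\<^sub>R F x)" for x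
    using mult_right_mono[OF g(2)[of x], of "\<bar>indicator cell x * F x\<bar>"]
    by (simp add: mult.commute)
  have B0: "B \<ge> 0" using g(2)[of 0] norm_ge_zero order_trans by blast
  have i: "integrable lborel (\<lambda>x. (indicator cell x *\<^sub>R F x) *\<^sub>R g x)"
    by (rule Bochner_Integration.integrable_bound[OF F2 m]) (use b B0 in auto)
  then show "set_integrable lborel cell (\<lambda>x. F x *\<^sub>R g x)" by (simp add: set_integrable_def)
  have "norm (LINT x|lborel. (indicator cell x *\<^sub>R F x) *\<^sub>R g x) \<le> (LINT x|lborel. B * norm (indicator cell x *\<^sub>R F x))"
    by (rule Bochner_Integration.integral_norm_bound_integral[OF i F2 b])
  also have "\<dots> = B * torus_integral (\<lambda>x. \<bar>F x\<bar>)"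
    by (simp add: set_lebesgue_integral_def abs_mult)
  finally show "norm (torus_integral (\<lambda>x. F x *\<^sub>R g x)) \<le> torus_integral (\<lambda>x. \<bar>F x\<bar>) * B"
    by (simp add: set_lebesgue_integral_def mult.commute)
qed

section \<open>Convolution on the torus\<close>

lemma Ck_on_1D:
  assumes "Ck_on 1 UNIV f"
  shows "f differentiable (at x)" "continuous_on UNIV (pderiv_dir i f)" "continuous_on UNIV f"
  using assms Ck_on_continuous[OF assms] by auto

lemma Ck_on_2D:
  assumes "Ck_on 2 UNIV f"
  shows "Ck_on 1 UNIV f" "Ck_on 1 UNIV (pderiv_dir i f)"
proof -
  show "Ck_on 1 UNIV f" by (rule Ck_on_mono[OF assms]) simp
  have "Ck_on (Suc 1) UNIV f" using assms by (simp only: Suc_1)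
  then show "Ck_on 1 UNIV (pderiv_dir i f)" by (simp only: Ck_on.simps)
qed

lemma Ck_on_2_smooth: "smooth_on UNIV f \<Longrightarrow> Ck_on 2 UNIV f"
  by (simp only: smooth_on_def)

lemma periodic_pderiv_dir:
  assumes "periodic f" "\<And>x. f differentiable (at x)"
  shows "periodic (pderiv_dir i f)"
proof -
  have "pderiv_dir i f (x + axis j 1) = pderiv_dir i f x" for x j
  proof -
    have "(\<lambda>x. f (axis j 1 + x)) = f"
      using assms(1) unfolding periodic_def by (simp add: add.commute)
    then show ?thesis
      using fun_cong[OF pderiv_dir_affine(2)[OF assms(2), of i 1 "axis j 1" 1], of x]
      by (simp add: add.commute)
  qed
  then show ?thesis by (simp add: periodic_def)
qed

text \<open>Two nearby points can be moved by a common period into one fixed ball, on which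
  compactness applies.\<close>

lemma periodic_uniformly_continuous:
  fixes f :: "real^2 \<Rightarrow> 'b::metric_space"
  assumes per: "periodic f" and cont: "continuous_on UNIV f" and e: "e > 0"
  obtains d where "d > 0" "\<And>x y. dist x y < d \<Longrightarrow> dist (f x) (f y) < e"
proof -
  have "uniformly_continuous_on (cball 0 3) f"
    by (intro compact_uniformly_continuous continuous_on_subset[OF cont]) auto
  then obtain d where d: "d > 0"
    "\<And>x y. x \<in> cball 0 3 \<Longrightarrow> y \<in> cball 0 3 \<Longrightarrow> dist x y < d \<Longrightarrow> dist (f x) (f y) < e"
    using e unfolding uniformly_continuous_on_def by (metis dist_commute)
  have "dist (f x) (f y) < e" if xy: "dist x y < min d 1" for x y
  proof -
    obtain k where k: "\<forall>i. k$i \<in> \<int>" "x - k \<in> cell" using exists_cell_representative[of x] by blast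
    have "norm (x - k) \<le> \<bar>(x - k)$1\<bar> + \<bar>(x - k)$2\<bar>"
      using norm_le_l1_cart[of "x - k"] by (simp add: sum_2)
    moreover have "\<bar>(x - k)$1\<bar> \<le> 1/2" "\<bar>(x - k)$2\<bar> \<le> 1/2" using k(2) unfolding cell_iff by blast+
    ultimately have n: "norm (x - k) \<le> 1" by linarith
    have "dist (x - k) (y - k) < 1" "dist (x - k) (y - k) < d"
      using xy by (simp_all add: dist_norm)
    moreover from this(1) n have "norm (y - k) \<le> 3"
      by (smt (verit) dist_norm norm_minus_commute norm_triangle_sub)
    ultimately have "dist (f (x - k)) (f (y - k)) < e"
      using n by (intro d(2)) auto
    then show ?thesis
      using periodic_Ints_shift[OF per k(1), of "x - k"] periodic_Ints_shift[OF per k(1), of "y - k"] by simp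
  qed
  then show ?thesis using that[of "min d 1"] d(1) by simp
qed

lemma periodic_tconv: "periodic g \<Longrightarrow> periodic (tconv g F)"
  unfolding periodic_def tconv_def by (simp add: diff_add_eq[symmetric])

lemma continuous_reflect: "continuous_on UNIV g \<Longrightarrow> continuous_on UNIV (\<lambda>x. g ((a::real^2) - x))"
  by (rule continuous_on_compose2[of UNIV g]) (auto intro!: continuous_intros)

lemma tconv_integrable:
  fixes g :: "real^2 \<Rightarrow> 'b::{banach,second_countable_topology}"
  assumes "periodic g" "continuous_on UNIV g" "set_integrable lborel cell F"
  shows "set_integrable lborel cell (\<lambda>x. F x *\<^sub>R g (a - x))"
proof -
  obtain B where B: "\<And>x. norm (g x) \<le> B" using periodic_bounded[OF assms(1,2)] by blast
  show ?thesis
    by (rule set_integrable_bounded_scaleR(1)[OF assms(3) continuous_reflect[OF assms(2)] B])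
qed

lemma continuous_tconv:
  fixes g :: "real^2 \<Rightarrow> 'b::{banach,second_countable_topology}"
  assumes per: "periodic g" and cont: "continuous_on UNIV g" and F: "set_integrable lborel cell F"
  shows "continuous_on UNIV (tconv g F)"
  unfolding continuous_on_iff
proof safe
  fix a :: "real^2" and e :: real
  assume e: "e > 0"
  let ?N = "torus_integral (\<lambda>x. \<bar>F x\<bar>)"
  have N: "?N \<ge> 0" by (simp add: set_lebesgue_integral_def)
  obtain d where d: "d > 0" "\<And>x y. dist x y < d \<Longrightarrow> dist (g x) (g y) < e / (?N + 1)"
    using periodic_uniformly_continuous[OF per cont, of "e / (?N + 1)"] e N by auto
  have "dist (tconv g F y) (tconv g F a) < e" if y: "dist y a < d" for y
  proof -
    have eq: "tconv g F y - tconv g F a = torus_integral (\<lambda>x. F x *\<^sub>R (g (y - x) - g (a - x)))"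
      unfolding tconv_def scaleR_diff_right
      by (rule set_integral_diff(2)[symmetric]) (intro tconv_integrable per cont F)+
    have "norm (tconv g F y - tconv g F a) \<le> ?N * (e / (?N + 1))"
      unfolding eq
    proof (rule set_integrable_bounded_scaleR(2)[OF F])
      show "continuous_on UNIV (\<lambda>x. g (y - x) - g (a - x))"
        by (intro continuous_on_diff continuous_reflect cont)
      show "norm (g (y - x) - g (a - x)) \<le> e / (?N + 1)" for x
        using d(2)[of "y - x" "a - x"] y by (simp add: dist_norm less_imp_le)
    qed
    also have "\<dots> < e" using e N by (simp add: field_simps)
    finally show ?thesis by (simp add: dist_norm)
  qed
  with d(1) show "\<exists>d>0. \<forall>x'\<in>UNIV. dist x' a < d \<longrightarrow> dist (tconv g F x') (tconv g F a) < e" by blast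
qed

text \<open>Differentiation under an integral against a kernel that is only integrable: since
  the partial derivatives of \<open>g\<close> are uniformly continuous, the linearisation error of \<open>g\<close> is
  \<open>o(|h|)\<close> uniformly in the base point, and it is then integrated against \<open>\<bar>F\<bar>\<close>.\<close>

lemma tconv_has_derivative:
  fixes g :: "real^2 \<Rightarrow> 'b::{banach,second_countable_topology}"
  assumes per: "periodic g" and C1: "Ck_on 1 UNIV g" and F: "set_integrable lborel cell F"
  shows "(tconv g F has_derivative
    (\<lambda>h. h$1 *\<^sub>R tconv (pderiv_dir 1 g) F a + h$2 *\<^sub>R tconv (pderiv_dir 2 g) F a)) (at a)"
  unfolding has_derivative_at_alt
proof (intro conjI allI impI)
  note cont = Ck_on_1D(2)[OF C1] Ck_on_1D(3)[OF C1]
  note perD = periodic_pderiv_dir[OF per Ck_on_1D(1)[OF C1]]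
  show "bounded_linear (\<lambda>h. h$1 *\<^sub>R tconv (pderiv_dir 1 g) F a + h$2 *\<^sub>R tconv (pderiv_dir 2 g) F a)"
    by (intro bounded_linear_add bounded_linear_scaleR_const bounded_linear_vec_nth)
  fix e :: real assume e: "e > 0"
  let ?N = "torus_integral (\<lambda>x. \<bar>F x\<bar>)"
  have N: "?N \<ge> 0" by (simp add: set_lebesgue_integral_def)
  \<comment> \<open>Each of the two partial derivatives contributes \<open>e'\<close> to the error; the \<open>+ 1\<close> avoids
    dividing by 0 when \<open>F\<close> vanishes almost everywhere.\<close>
  define e' where "e' = e / (2 * (?N + 1))"
  have e': "e' > 0" using e N by (simp add: e'_def)
  obtain d1 where d1: "d1 > 0" "\<And>x y. dist x y < d1 \<Longrightarrow> dist (pderiv_dir 1 g x) (pderiv_dir 1 g y) < e'"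
    using periodic_uniformly_continuous[OF perD cont(1) e', of 1] by blast
  obtain d2 where d2: "d2 > 0" "\<And>x y. dist x y < d2 \<Longrightarrow> dist (pderiv_dir 2 g x) (pderiv_dir 2 g y) < e'"
    using periodic_uniformly_continuous[OF perD cont(1) e', of 2] by blast
  define D where "D z h = (h::real^2)$1 *\<^sub>R pderiv_dir 1 g z + h$2 *\<^sub>R pderiv_dir 2 g z" for z h
  have "norm (tconv g F y - tconv g F a - ((y - a)$1 *\<^sub>R tconv (pderiv_dir 1 g) F a
        + (y - a)$2 *\<^sub>R tconv (pderiv_dir 2 g) F a)) \<le> e * norm (y - a)"
    if y: "norm (y - a) < min d1 d2" for y
  proof -
    let ?r = "\<lambda>x. g (y - x) - g (a - x) - D (a - x) (y - a)"
    have bound: "norm (?r x) \<le> norm (y - a) * (2 * e')" for x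
    proof -
      have "norm (g (y - x) - g (a - x) - D (a - x) ((y - x) - (a - x))) \<le> norm ((y - x) - (a - x)) * (2 * e')"
      proof (rule differentiable_bound_linearization[of "a - x" "y - x"
            "ball (a - x) (min d1 d2)" g D "a - x"])
        let ?S = "ball (a - x) (min d1 d2)"
        show "a - x + t *\<^sub>R (y - x - (a - x)) \<in> ?S" if "t \<in> {0..1}" for t
        proof -
          have "norm (t *\<^sub>R (y - a)) \<le> 1 * norm (y - a)"
            unfolding norm_scaleR using that by (intro mult_right_mono) auto
          also have "\<dots> < min d1 d2" using y by simp
          finally show ?thesis by (simp add: dist_norm)
        qed
        show "a - x \<in> ?S" using d1 d2 by simp
        show "(g has_derivative D z) (at z within ?S)" for z
          by (rule has_derivative_at_withinI[OF has_derivative_pderivs[OF Ck_on_1D(1)[OF C1],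
                  folded D_def]])
        show "onorm (D z - D (a - x)) \<le> 2 * e'" if z: "z \<in> ?S" for z
        proof (rule onorm_le)
          fix h :: "real^2"
          have "D z h - D (a - x) h = h$1 *\<^sub>R (pderiv_dir 1 g z - pderiv_dir 1 g (a - x))
              + h$2 *\<^sub>R (pderiv_dir 2 g z - pderiv_dir 2 g (a - x))"
            by (simp add: D_def algebra_simps)
          also have "norm \<dots> \<le> \<bar>h$1\<bar> * norm (pderiv_dir 1 g z - pderiv_dir 1 g (a - x))
              + \<bar>h$2\<bar> * norm (pderiv_dir 2 g z - pderiv_dir 2 g (a - x))"
            by (rule order_trans[OF norm_triangle_ineq]) simp
          also have "\<dots> \<le> norm h * e' + norm h * e'"
            using d1(2)[of z "a - x"] d2(2)[of z "a - x"] z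
            by (intro add_mono mult_mono component_le_norm_cart) (auto simp: dist_norm norm_minus_commute)
          finally show "norm ((D z - D (a - x)) h) \<le> 2 * e' * norm h" by simp
        qed
      qed
      then show ?thesis by simp
    qed
    have cD: "continuous_on UNIV (\<lambda>x. D (a - x) h)" for h
      unfolding D_def by (intro continuous_intros continuous_reflect cont)
    have i1: "set_integrable lborel cell (\<lambda>x. F x *\<^sub>R g (y - x) - F x *\<^sub>R g (a - x))"
      by (intro set_integral_diff tconv_integrable per cont F)
    have i2: "set_integrable lborel cell (\<lambda>x. c *\<^sub>R (F x *\<^sub>R pderiv_dir i g (a - x)))" for c i
      by (rule set_integrable_scaleR_right) (intro tconv_integrable perD cont F)
    have i3: "set_integrable lborel cell (\<lambda>x. (y - a)$1 *\<^sub>R (F x *\<^sub>R pderiv_dir 1 g (a - x))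
        + (y - a)$2 *\<^sub>R (F x *\<^sub>R pderiv_dir 2 g (a - x)))"
      by (intro set_integral_add i2)
    have "torus_integral (\<lambda>x. F x *\<^sub>R ?r x)
      = torus_integral (\<lambda>x. (F x *\<^sub>R g (y - x) - F x *\<^sub>R g (a - x)) -
         ((y - a)$1 *\<^sub>R (F x *\<^sub>R pderiv_dir 1 g (a - x)) + (y - a)$2 *\<^sub>R (F x *\<^sub>R pderiv_dir 2 g (a - x))))"
      by (simp add: D_def algebra_simps)
    also have "\<dots> = tconv g F y - tconv g F a - ((y - a)$1 *\<^sub>R tconv (pderiv_dir 1 g) F a
        + (y - a)$2 *\<^sub>R tconv (pderiv_dir 2 g) F a)"
      unfolding set_integral_diff(2)[OF i1 i3] set_integral_add(2)[OF i2 i2] tconv_def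
        set_integral_scaleR_right
        set_integral_diff(2)[OF tconv_integrable[OF per cont(2) F] tconv_integrable[OF per cont(2) F]]
      by (rule refl)
    finally have eq: "tconv g F y - tconv g F a - ((y - a)$1 *\<^sub>R tconv (pderiv_dir 1 g) F a
        + (y - a)$2 *\<^sub>R tconv (pderiv_dir 2 g) F a) = torus_integral (\<lambda>x. F x *\<^sub>R ?r x)" by simp
    have "norm (torus_integral (\<lambda>x. F x *\<^sub>R ?r x)) \<le> ?N * (norm (y - a) * (2 * e'))"
      by (rule set_integrable_bounded_scaleR(2)[OF F _ bound])
        (intro continuous_on_diff continuous_reflect cont cD)
    also have "\<dots> = (?N / (?N + 1)) * (e * norm (y - a))" using N by (simp add: e'_def field_simps)
    also have "\<dots> \<le> 1 * (e * norm (y - a))" using N e by (intro mult_right_mono) auto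
    finally show ?thesis unfolding eq by simp
  qed
  moreover have "min d1 d2 > 0" using d1 d2 by simp
  ultimately show "\<exists>d>0. \<forall>y. norm (y - a) < d \<longrightarrow> norm (tconv g F y - tconv g F a -
      ((y - a)$1 *\<^sub>R tconv (pderiv_dir 1 g) F a + (y - a)$2 *\<^sub>R tconv (pderiv_dir 2 g) F a)) \<le> e * norm (y - a)"
    by blast
qed

lemma pderiv_dir_tconv:
  fixes g :: "real^2 \<Rightarrow> 'b::{banach,second_countable_topology}"
  assumes "periodic g" "Ck_on 1 UNIV g" "set_integrable lborel cell F"
  shows "pderiv_dir i (tconv g F) = tconv (pderiv_dir i g) F"
proof
  fix a
  consider "i = 1" | "i = 2" using exhaust_2[of i] by blast
  then show "pderiv_dir i (tconv g F) a = tconv (pderiv_dir i g) F a"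
    unfolding pderiv_dir_eq[OF tconv_has_derivative[OF assms]] by cases (simp_all add: axis_def)
qed

lemma Ck_on_tconv:
  fixes g :: "real^2 \<Rightarrow> 'b::{banach,second_countable_topology}"
  assumes "periodic g" "Ck_on k UNIV g" "set_integrable lborel cell F"
  shows "Ck_on k UNIV (tconv g F)"
  using assms
proof (induction k arbitrary: g)
  case 0
  then show ?case by (simp add: continuous_tconv)
next
  case (Suc k)
  have C1: "Ck_on 1 UNIV g" using Ck_on_mono[OF Suc.prems(2), of 1] by simp
  have "tconv g F differentiable (at x)" for x
    using tconv_has_derivative[OF Suc.prems(1) C1 Suc.prems(3)] unfolding differentiable_def by blast
  moreover have "Ck_on k UNIV (tconv (pderiv_dir i g) F)" for i
    using Suc.prems periodic_pderiv_dir[OF Suc.prems(1) Ck_on_1D(1)[OF C1]] by (intro Suc.IH) auto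
  ultimately show ?case by (simp add: pderiv_dir_tconv[OF Suc.prems(1) C1 Suc.prems(3)])
qed

text \<open>Allows the derivatives of a potential \<open>G * f\<close> to be placed on the smooth factor.\<close>

lemma tconv_commute:
  fixes f g :: "real^2 \<Rightarrow> real"
  assumes f: "periodic f" "set_integrable lborel cell f" and g: "periodic g" "continuous_on UNIV g"
  shows "tconv f g = tconv g f"
proof
  fix a
  let ?H = "\<lambda>x. f x *\<^sub>R g (a - x)"
  have p: "g (a - (x + axis i 1)) = g (a - x)" for x i
  proof -
    have "g (a - (x + axis i 1) + axis i 1) = g (a - (x + axis i 1))"
      using g(1) unfolding periodic_def by blast
    then show ?thesis by simp
  qed
  have "periodic ?H" using f(1) p by (simp add: periodic_def)
  from torus_reflect(2)[OF this tconv_integrable[OF g f(2)], of a]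
  show "tconv f g a = tconv g f a" by (simp add: tconv_def mult.commute)
qed

text \<open>The convolution of \<open>w\<close> with the constant 1 is constant by translation invariance, and
  its derivative is the convolution of the derivative of \<open>w\<close> with 1.\<close>

lemma torus_integral_pderiv_dir:
  fixes w :: "real^2 \<Rightarrow> 'b::{banach,second_countable_topology}"
  assumes per: "periodic w" and C1: "Ck_on 1 UNIV w"
  shows "torus_integral (pderiv_dir i w) = 0"
proof -
  have one: "set_integrable lborel cell (\<lambda>x. 1 :: real)"
    by (intro continuous_torus_integrable continuous_intros)
  have "tconv w (\<lambda>_. 1) = (\<lambda>a. torus_integral w)"
    unfolding tconv_def
    using torus_reflect(2)[OF per continuous_torus_integrable[OF Ck_on_1D(3)[OF C1]]] by simp
  then have "pderiv_dir i (tconv w (\<lambda>_. 1)) 0 = 0"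
    by (simp add: pderiv_dir_eq[OF has_derivative_const])
  then show ?thesis
    using torus_reflect(2)[OF periodic_pderiv_dir[OF per Ck_on_1D(1)[OF C1]]
        continuous_torus_integrable[OF Ck_on_1D(2)[OF C1]], of i 0]
    by (simp add: pderiv_dir_tconv[OF per C1 one] tconv_def)
qed

lemma torus_integral_by_parts:
  fixes v w :: "real^2 \<Rightarrow> real"
  assumes "periodic v" "Ck_on 1 UNIV v" "periodic w" "Ck_on 1 UNIV w"
  shows "torus_integral (\<lambda>x. pderiv_dir i v x * w x) = - torus_integral (\<lambda>x. v x * pderiv_dir i w x)"
proof -
  note d = Ck_on_1D(1)[OF assms(2)] Ck_on_1D(1)[OF assms(4)]
  note c = Ck_on_1D(2,3)[OF assms(2)] Ck_on_1D(2,3)[OF assms(4)]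
  have eq: "pderiv_dir i (\<lambda>x. v x * w x) = (\<lambda>x. v x * pderiv_dir i w x + pderiv_dir i v x * w x)" for i
    using d by (auto simp: pderiv_dir_mult)
  have "Ck_on 1 UNIV (\<lambda>x. v x * w x)"
    by (auto simp: eq intro!: differentiable_mult d continuous_intros c)
  moreover have "periodic (\<lambda>x. v x * w x)" using assms(1,3) by (simp add: periodic_def)
  ultimately have "torus_integral (\<lambda>x. v x * pderiv_dir i w x + pderiv_dir i v x * w x) = 0"
    using torus_integral_pderiv_dir[of "\<lambda>x. v x * w x" i] eq by simp
  moreover have "torus_integral (\<lambda>x. v x * pderiv_dir i w x + pderiv_dir i v x * w x)
    = torus_integral (\<lambda>x. v x * pderiv_dir i w x) + torus_integral (\<lambda>x. pderiv_dir i v x * w x)"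
    by (intro set_integral_add(2) continuous_torus_integrable continuous_intros c)
  ultimately show ?thesis by simp
qed

lemma laplacian_2: "laplacian f x = pderiv_dir 1 (pderiv_dir 1 f) x + pderiv_dir 2 (pderiv_dir 2 f) x"
  by (simp add: laplacian_def sum_2)

lemma green_identity:
  fixes u v :: "real^2 \<Rightarrow> real"
  assumes u: "periodic u" "Ck_on 2 UNIV u" and v: "periodic v" "Ck_on 1 UNIV v"
  shows "torus_integral (\<lambda>x. pderiv_dir 1 u x * pderiv_dir 1 v x + pderiv_dir 2 u x * pderiv_dir 2 v x)
    = - torus_integral (\<lambda>x. laplacian u x * v x)"
proof -
  note u1 = Ck_on_2D(1)[OF u(2)]
  note pu = periodic_pderiv_dir[OF u(1) Ck_on_1D(1)[OF u1]]
  note cu = Ck_on_1D(2,3)[OF Ck_on_2D(2)[OF u(2)]]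
  note cv = Ck_on_1D(2,3)[OF v(2)]
  note p = torus_integral_by_parts[OF pu Ck_on_2D(2)[OF u(2)] v]
  have "torus_integral (\<lambda>x. pderiv_dir 1 u x * pderiv_dir 1 v x + pderiv_dir 2 u x * pderiv_dir 2 v x)
    = torus_integral (\<lambda>x. pderiv_dir 1 u x * pderiv_dir 1 v x)
      + torus_integral (\<lambda>x. pderiv_dir 2 u x * pderiv_dir 2 v x)"
    by (intro set_integral_add(2) continuous_torus_integrable continuous_intros cu cv)
  also have "\<dots> = - (torus_integral (\<lambda>x. pderiv_dir 1 (pderiv_dir 1 u) x * v x)
      + torus_integral (\<lambda>x. pderiv_dir 2 (pderiv_dir 2 u) x * v x))"
    using p[of 1 1] p[of 2 2] by simp
  also have "torus_integral (\<lambda>x. pderiv_dir 1 (pderiv_dir 1 u) x * v x)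
      + torus_integral (\<lambda>x. pderiv_dir 2 (pderiv_dir 2 u) x * v x)
    = torus_integral (\<lambda>x. laplacian u x * v x)"
    unfolding laplacian_2 distrib_right
    by (intro set_integral_add(2)[symmetric] continuous_torus_integrable continuous_intros cu cv)
  finally show ?thesis .
qed

lemma torus_integral_nonneg_eq_0:
  fixes f :: "real^2 \<Rightarrow> real"
  assumes "continuous_on UNIV f" "\<And>x. f x \<ge> 0" "torus_integral f = 0" "x \<in> cell"
  shows "f x = 0"
proof (rule has_integral_0_cbox_imp_0[OF _ _ _ _ assms(4)])
  show "continuous_on cell f" using assms(1) by (rule continuous_on_subset) simp
  show "(f has_integral 0) cell"
    using set_borel_integral_eq_integral[OF continuous_torus_integrable[OF assms(1)]] assms(3)
    by (metis integrable_integral)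
  have "0 \<in> box (vec (-1/2)) (vec (1/2) :: real^2)" by (simp add: mem_box_cart)
  then show "box (vec (-1/2)) (vec (1/2) :: real^2) \<noteq> {}" by blast
qed (use assms in auto)

text \<open>By Green's identity with both functions equal to \<open>w\<close>, the Dirichlet integral of \<open>w\<close>
  vanishes.\<close>

lemma periodic_harmonic_constant:
  fixes w :: "real^2 \<Rightarrow> real"
  assumes per: "periodic w" and C2: "Ck_on 2 UNIV w" and harm: "\<And>x. laplacian w x = 0"
  shows "w x = w y"
proof -
  note C1 = Ck_on_2D(1)[OF C2]
  note d = Ck_on_1D(1)[OF C1]
  let ?f = "\<lambda>x. pderiv_dir 1 w x * pderiv_dir 1 w x + pderiv_dir 2 w x * pderiv_dir 2 w x"
  have "torus_integral ?f = 0"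
    unfolding green_identity[OF per C2 per C1] harm by (simp add: set_lebesgue_integral_def)
  moreover have "continuous_on UNIV ?f" by (intro continuous_intros Ck_on_1D(2)[OF C1])
  ultimately have f0: "?f x = 0" if "x \<in> cell" for x
    using that by (intro torus_integral_nonneg_eq_0[of ?f]) auto
  have p: "periodic (pderiv_dir i w)" for i by (rule periodic_pderiv_dir[OF per d])
  have "pderiv_dir i w x = 0" for i x
  proof (rule periodic_eqI[OF p])
    fix x :: "real^2" assume "x \<in> cell"
    from f0[OF this] have "pderiv_dir 1 w x = 0" "pderiv_dir 2 w x = 0"
      by (simp_all add: sum_squares_eq_zero_iff)
    then show "pderiv_dir i w x = 0" using exhaust_2[of i] by auto
  qed (simp add: periodic_def)
  then have "(w has_derivative (\<lambda>h. 0)) (at x)" for x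
    using has_derivative_pderivs[OF d, of x] by simp
  then show ?thesis
    using has_derivative_zero_constant[of UNIV w] by (metis UNIV_I convex_UNIV)
qed

text \<open>In the double integral of Fubini's theorem only the continuous function \<open>g\<close> is
  translated. This matters for measurability, because \<open>F\<close> is only known to be measurable on
  the cell.\<close>

lemma torus_integral_tconv:
  fixes g F :: "real^2 \<Rightarrow> real"
  assumes g: "periodic g" "continuous_on UNIV g" and F: "set_integrable lborel cell F"
  shows "torus_integral (tconv g F) = torus_integral g * torus_integral F"
proof -
  let ?F = "\<lambda>x. indicator cell x *\<^sub>R F x"
  define h where "h = (\<lambda>x a. ?F x * (indicator cell a * g (a - x)))"
  have F': "integrable lborel ?F" using F by (simp add: set_integrable_def)
  have mF: "?F \<in> borel_measurable borel" using borel_measurable_integrable[OF F'] by simp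
  have mg: "g \<in> borel_measurable borel" using g(2) by (rule borel_measurable_continuous_onI)
  have meas: "case_prod h \<in> borel_measurable (lborel \<Otimes>\<^sub>M lborel)"
  proof -
    have eq: "case_prod h = (\<lambda>z. ?F (fst z) * (indicator cell (snd z) * g (snd z - fst z)))"
      by (auto simp: h_def)
    have m1: "(\<lambda>z. ?F (fst z)) \<in> borel_measurable (lborel \<Otimes>\<^sub>M lborel)"
      by (rule measurable_compose[OF _ mF]) simp
    have m2: "(\<lambda>z. indicator cell (snd z) * g (snd z - fst z)) \<in> borel_measurable (lborel \<Otimes>\<^sub>M lborel)"
      by (intro borel_measurable_times measurable_compose[OF _ mg]) measurable
    show ?thesis unfolding eq by (rule borel_measurable_times[OF m1 m2])
  qed
  have shift: "torus_integral (\<lambda>a. f (a - x)) = torus_integral f"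
      "set_integrable lborel cell (\<lambda>a. f (a - x))"
    if "periodic f" "continuous_on UNIV f" for f :: "real^2 \<Rightarrow> real" and x
    using torus_shift[OF that(1) continuous_torus_integrable[OF that(2)], of "- x"] by simp_all
  have abs_g: "periodic (\<lambda>x. \<bar>g x\<bar>)" "continuous_on UNIV (\<lambda>x. \<bar>g x\<bar>)"
    using g by (auto simp: periodic_def intro!: continuous_intros)
  have int: "integrable (lborel \<Otimes>\<^sub>M lborel) (case_prod h)"
  proof (rule lborel_pair.Fubini_integrable[OF meas])
    have "(LINT a|lborel. norm (case_prod h (x, a))) = \<bar>?F x\<bar> * torus_integral (\<lambda>x. \<bar>g x\<bar>)" for x
    proof -
      have "(LINT a|lborel. norm (case_prod h (x, a))) = (LINT a|lborel. \<bar>?F x\<bar> * (indicator cell a *\<^sub>R \<bar>g (a - x)\<bar>))"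
        by (simp add: h_def abs_mult)
      also have "\<dots> = \<bar>?F x\<bar> * torus_integral (\<lambda>a. \<bar>g (a - x)\<bar>)"
        unfolding set_lebesgue_integral_def by (rule integral_mult_right_zero)
      finally show ?thesis unfolding shift(1)[OF abs_g] .
    qed
    then show "integrable lborel (\<lambda>x. LINT a|lborel. norm (case_prod h (x, a)))"
      using F' by (simp only: integrable_mult_left integrable_abs)
    have "integrable lborel (\<lambda>a. ?F x * (indicator cell a *\<^sub>R g (a - x)))" for x
      using shift(2)[OF g, of x] unfolding set_integrable_def by (intro integrable_mult_right)
    then show "AE x in lborel. integrable lborel (\<lambda>a. case_prod h (x, a))"
      by (simp add: h_def)
  qed
  have "torus_integral (tconv g F) = (LINT a|lborel. LINT x|lborel. h x a)"
    unfolding tconv_def set_lebesgue_integral_def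
    by (simp add: h_def ac_simps flip: integral_mult_right_zero)
  also have "\<dots> = (LINT x|lborel. LINT a|lborel. h x a)"
    by (rule lborel_pair.Fubini_integral[OF int])
  also have "\<dots> = (LINT x|lborel. ?F x * torus_integral g)"
  proof -
    have "(LINT a|lborel. h x a) = ?F x * torus_integral (\<lambda>a. g (a - x))" for x
      unfolding h_def set_lebesgue_integral_def by simp
    then show ?thesis unfolding shift(1)[OF g] by simp
  qed
  also have "\<dots> = torus_integral g * torus_integral F"
    unfolding set_lebesgue_integral_def by (simp add: mult.commute)
  finally show ?thesis .
qed

section \<open>Periodisation of compactly supported functions\<close>

text \<open>The strict inequality makes the region where \<open>h\<close> must vanish open, so the derivatives
  of \<open>h\<close> vanish on it too, with the same \<open>r\<close>.\<close>

definition supported_in_square :: "real \<Rightarrow> (real^2 \<Rightarrow> real) \<Rightarrow> bool" where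
  "supported_in_square r h \<longleftrightarrow> (\<forall>x i. r < \<bar>x$i\<bar> \<longrightarrow> h x = 0)"

lemma supported_in_squareD: "supported_in_square r h \<Longrightarrow> r < \<bar>x$i\<bar> \<Longrightarrow> h x = 0"
  by (auto simp: supported_in_square_def)

lemma supported_in_square_pderiv_dir:
  assumes "supported_in_square r h"
  shows "supported_in_square r (pderiv_dir i h)"
  unfolding supported_in_square_def
proof (intro allI impI)
  fix x :: "real^2" and j :: 2 assume "r < \<bar>x$j\<bar>"
  moreover have "open {y::real^2. r < \<bar>y$j\<bar>}"
    by (intro open_Collect_less continuous_intros)
  ultimately have "(h has_derivative (\<lambda>_. 0)) (at x)"
    using assms
    by (intro has_derivative_transform_within_open[of "\<lambda>_. 0" "\<lambda>_. 0" x UNIV "{y. r < \<bar>y$j\<bar>}" h])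
      (auto dest: supported_in_squareD)
  then show "pderiv_dir i h x = 0" by (simp add: pderiv_dir_eq)
qed

lemma periodic_on_torus: "periodic (on_torus f)"
proof -
  have r: "round (x$j + axis i 1$j) = round (x$j) + (if j = i then 1 else 0)" for x :: "real^2" and i j
  proof -
    have "\<lfloor>x$j + 1 + 1/2\<rfloor> = \<lfloor>x$j + 1/2\<rfloor> + 1" by linarith
    then show ?thesis by (cases "j = i") (simp_all add: axis_def round_def)
  qed
  have "(\<chi> j. (x + axis i 1)$j - of_int (round ((x + axis i 1)$j))) = (\<chi> j. x$j - of_int (round (x$j)))"
    for x :: "real^2" and i
    by (simp add: vec_eq_iff r) (simp add: axis_def)
  then show ?thesis by (simp add: periodic_def on_torus_def)
qed

text \<open>If \<open>r < \<bar>t\<bar> < 1 - r\<close> then every integer has distance more than \<open>r\<close> from \<open>t\<close>, so outside the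
  square of half-width \<open>r\<close> both sides vanish. The equation thus holds on an open neighbourhood of
  the closed cell, in particular across its boundary, where the representative modulo 1 jumps.\<close>

lemma on_torus_eq_near_cell:
  assumes h: "supported_in_square r h" and r: "r < 1/2" and x: "\<And>i. \<bar>x$i\<bar> < 1 - r"
  shows "on_torus h x = h x"
proof (cases "\<exists>i. r < \<bar>x$i\<bar>")
  case True
  then obtain i where i: "r < \<bar>x$i\<bar>" by blast
  have "r < \<bar>x$i - of_int n\<bar>" for n
  proof (cases "n = 0")
    case False
    then have "\<bar>of_int n :: real\<bar> \<ge> 1" by linarith
    then show ?thesis using x[of i] by linarith
  qed (use i in simp)
  then have "r < \<bar>(\<chi> i. x $ i - of_int (round (x $ i)))$i\<bar>" by simp
  then show ?thesis
    using supported_in_squareD[OF h i] supported_in_squareD[OF h] unfolding on_torus_def by metis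
next
  case False
  have "round (x$i) = 0" for i
  proof (rule round_unique')
    have "\<bar>x$i\<bar> \<le> r" using False by (simp add: not_less)
    then show "\<bar>x$i - of_int 0\<bar> < 1/2" using r by simp
  qed
  then have "(\<chi> i. x $ i - of_int (round (x $ i))) = x" by (simp add: vec_eq_iff)
  then show ?thesis by (simp add: on_torus_def)
qed

lemma on_torus_eq_on_cell:
  assumes "supported_in_square r h" "r < 1/2" "x \<in> cell"
  shows "on_torus h x = h x"
proof (rule on_torus_eq_near_cell[OF assms(1,2)])
  fix i
  have "\<bar>x$i\<bar> \<le> 1/2" using assms(3) unfolding cell_iff by blast
  then show "\<bar>x$i\<bar> < 1 - r" using assms(2) by linarith
qed

text \<open>Through this local form a periodised function inherits continuity and derivatives
  from the original one. The affine expression on the right is written as it appears in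
  \<open>pderiv_dir_affine\<close>.\<close>

lemma on_torus_local_form:
  assumes h: "supported_in_square r h" and r: "r < 1/2"
  obtains S k where "open S" "x \<in> S" "\<forall>i. k$i \<in> \<int>" "x - k \<in> cell"
    "\<forall>y\<in>S. on_torus h y = 1 *\<^sub>R h (- k + 1 *\<^sub>R y)"
proof -
  obtain k where k: "\<forall>i. k$i \<in> \<int>" "x - k \<in> cell" using exists_cell_representative[of x] by blast
  let ?S = "{y. \<bar>y$1 - k$1\<bar> < 1 - r \<and> \<bar>y$2 - k$2\<bar> < 1 - r}"
  have "open ?S" by (intro open_Collect_conj open_Collect_less continuous_intros)
  moreover have "\<bar>(x - k)$1\<bar> \<le> 1/2" "\<bar>(x - k)$2\<bar> \<le> 1/2" using k(2) unfolding cell_iff by blast+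
  then have "x \<in> ?S" using r by auto
  moreover have "on_torus h y = 1 *\<^sub>R h (- k + 1 *\<^sub>R y)" if "y \<in> ?S" for y
  proof -
    have "\<bar>(y - k)$i\<bar> < 1 - r" for i
      using that exhaust_2[of i] by auto
    then have "on_torus h (y - k) = h (y - k)" by (rule on_torus_eq_near_cell[OF h r])
    then show ?thesis using periodic_Ints_shift[OF periodic_on_torus k(1), of h "y - k"] by simp
  qed
  ultimately show ?thesis using that k by blast
qed

lemma pderiv_dir_on_torus:
  assumes h: "supported_in_square r h" and r: "r < 1/2" and d: "\<And>x. h differentiable (at x)"
  shows "on_torus h differentiable (at x)"
    and "pderiv_dir i (on_torus h) = on_torus (pderiv_dir i h)"
proof -
  have "on_torus h differentiable (at x) \<and> pderiv_dir i (on_torus h) x = on_torus (pderiv_dir i h) x" for x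
  proof -
    obtain S k where S: "open S" "x \<in> S" "\<forall>i. k$i \<in> \<int>" "x - k \<in> cell"
      "\<forall>y\<in>S. on_torus h y = 1 *\<^sub>R h (- k + 1 *\<^sub>R y)"
      by (rule on_torus_local_form[OF h r, of x])
    have D: "(on_torus h has_derivative
        (\<lambda>e. 1 *\<^sub>R frechet_derivative h (at (- k + 1 *\<^sub>R x)) (1 *\<^sub>R e))) (at x)"
      by (rule has_derivative_transform_within_open[OF pderiv_dir_affine(1)[OF d] S(1,2) S(5)[rule_format, symmetric]])
    have "pderiv_dir i (on_torus h) x = pderiv_dir i h (x - k)"
      unfolding pderiv_dir_eq[OF D] by (simp add: pderiv_dir_def)
    also have "\<dots> = on_torus (pderiv_dir i h) (x - k)"
      by (rule on_torus_eq_on_cell[OF supported_in_square_pderiv_dir[OF h] r S(4), symmetric])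
    also have "\<dots> = on_torus (pderiv_dir i h) x"
      using periodic_Ints_shift[OF periodic_on_torus S(3), of "pderiv_dir i h" "x - k"] by simp
    finally show ?thesis using D unfolding differentiable_def by blast
  qed
  then show "on_torus h differentiable (at x)"
    "pderiv_dir i (on_torus h) = on_torus (pderiv_dir i h)" by auto
qed

lemma Ck_on_on_torus:
  assumes "supported_in_square r h" "r < 1/2" "Ck_on k UNIV h"
  shows "Ck_on k UNIV (on_torus h)"
  using assms
proof (induction k arbitrary: h)
  case 0
  have "isCont (on_torus h) x" for x
  proof -
    obtain S k where S: "open S" "x \<in> S" "\<forall>i. k$i \<in> \<int>" "x - k \<in> cell"
      "\<forall>y\<in>S. on_torus h y = 1 *\<^sub>R h (- k + 1 *\<^sub>R y)"
      by (rule on_torus_local_form[OF 0(1,2), of x])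
    have "continuous_on UNIV (\<lambda>y. 1 *\<^sub>R h (- k + 1 *\<^sub>R y))"
      using Ck_on_affine[of 0 h 1 "- k" 1] 0(3) by simp
    then have "isCont (\<lambda>y. 1 *\<^sub>R h (- k + 1 *\<^sub>R y)) x" by (simp add: continuous_on_eq_continuous_at)
    moreover have "\<forall>\<^sub>F y in nhds x. on_torus h y = 1 *\<^sub>R h (- k + 1 *\<^sub>R y)"
      unfolding eventually_nhds using S(1,2,5) by blast
    ultimately show ?thesis by (simp only: isCont_cong)
  qed
  then show ?case by (simp add: continuous_on_eq_continuous_at)
next
  case (Suc k)
  then have d: "\<And>x. h differentiable (at x)" by simp
  have "Ck_on k UNIV (on_torus (pderiv_dir i h))" for i
    using Suc by (intro Suc.IH supported_in_square_pderiv_dir) auto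
  then show ?case
    using pderiv_dir_on_torus[OF Suc.prems(1,2) d] by simp
qed

lemma smooth_on_on_torus:
  "supported_in_square r h \<Longrightarrow> r < 1/2 \<Longrightarrow> smooth_on UNIV h \<Longrightarrow> smooth_on UNIV (on_torus h)"
  by (simp add: smooth_on_def Ck_on_on_torus)

lemma radial_mollifierD:
  assumes "radial_mollifier \<theta>"
  shows "smooth_on UNIV \<theta>" "\<theta> x \<ge> 0" "integral\<^sup>L lborel \<theta> = 1"
proof -
  note a = assms[unfolded radial_mollifier_def]
  show "smooth_on UNIV \<theta>" by (rule a[THEN conjunct1])
  show "\<theta> x \<ge> 0" by (rule a[THEN conjunct2, THEN conjunct2, THEN conjunct2, THEN conjunct1, THEN spec])
  show "integral\<^sup>L lborel \<theta> = 1" by (rule a[THEN conjunct2, THEN conjunct2, THEN conjunct2, THEN conjunct2])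
qed

lemma radial_mollifier_supported:
  assumes "radial_mollifier \<theta>"
  obtains r where "0 \<le> r" "r < 1/2" "supported_in_square r \<theta>"
proof -
  let ?S = "closure {x. \<theta> x \<noteq> 0}"
  have sub: "?S \<subseteq> box (vec (-1/2)) (vec (1/2))" using assms unfolding radial_mollifier_def by (elim conjE)
  have comp: "compact ?S"
    unfolding compact_eq_bounded_closed using bounded_subset[OF bounded_box sub] by simp
  have "?S \<noteq> {}"
  proof
    assume "?S = {}"
    then have "\<theta> = (\<lambda>_. 0)" by (auto simp: closure_eq_empty)
    then show False using assms by (simp add: radial_mollifier_def)
  qed
  moreover have "continuous_on ?S (\<lambda>x. max \<bar>x$1\<bar> \<bar>x$2\<bar>)" by (intro continuous_intros)
  ultimately obtain s where s: "s \<in> ?S" "\<forall>x\<in>?S. max \<bar>x$1\<bar> \<bar>x$2\<bar> \<le> max \<bar>s$1\<bar> \<bar>s$2\<bar>"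
    using continuous_attains_sup[OF comp] by blast
  have "\<bar>s$i\<bar> < 1/2" for i
  proof -
    have "s \<in> box (vec (-1/2)) (vec (1/2))" using s(1) sub by blast
    then have "-1/2 < s$i" "s$i < 1/2" unfolding mem_box_cart by simp_all
    then show ?thesis by linarith
  qed
  then have "max \<bar>s$1\<bar> \<bar>s$2\<bar> < 1/2" by (simp only: max_less_iff_conj)
  moreover have "supported_in_square (max \<bar>s$1\<bar> \<bar>s$2\<bar>) \<theta>"
    unfolding supported_in_square_def
  proof (intro allI impI)
    fix x :: "real^2" and i assume i: "max \<bar>s$1\<bar> \<bar>s$2\<bar> < \<bar>x$i\<bar>"
    show "\<theta> x = 0"
    proof (rule ccontr)
      assume "\<theta> x \<noteq> 0"
      then have "x \<in> ?S" by (intro subsetD[OF closure_subset]) simp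
      with s(2) have "max \<bar>x$1\<bar> \<bar>x$2\<bar> \<le> max \<bar>s$1\<bar> \<bar>s$2\<bar>" by blast
      moreover have "\<bar>x$i\<bar> \<le> max \<bar>x$1\<bar> \<bar>x$2\<bar>" using exhaust_2[of i] by auto
      ultimately show False using i by linarith
    qed
  qed
  moreover have "0 \<le> max \<bar>s$1\<bar> \<bar>s$2\<bar>" by simp
  ultimately show ?thesis using that by blast
qed

lemma integral_rescale:
  fixes f :: "real^2 \<Rightarrow> real"
  assumes l: "l > 0" and f: "integrable lborel f"
  shows "integrable lborel (\<lambda>y. f (l *\<^sub>R y))"
    and "integral\<^sup>L lborel f = l^2 * (LINT y|lborel. f (l *\<^sub>R y))"
proof -
  have eq: "lborel = density (distr lborel borel (\<lambda>x::real^2. 0 + l *\<^sub>R x)) (\<lambda>_. ennreal (\<bar>l\<bar>^DIM(real^2)))"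
    using lborel_affine[of l "0::real^2"] l by (simp add: ennreal_power)
  have [measurable]: "f \<in> borel_measurable borel" using borel_measurable_integrable[OF f] by simp
  have "integrable (density (distr lborel borel (\<lambda>x::real^2. 0 + l *\<^sub>R x)) (\<lambda>_. ennreal (\<bar>l\<bar>^DIM(real^2)))) f"
    using f eq by simp
  then have "integrable (distr lborel borel (\<lambda>x::real^2. 0 + l *\<^sub>R x)) (\<lambda>x. (\<bar>l\<bar>^DIM(real^2)) *\<^sub>R f x)"
    by (subst (asm) integrable_density) auto
  then have "integrable (distr lborel borel (\<lambda>x::real^2. 0 + l *\<^sub>R x)) f"
    using l by simp
  then show "integrable lborel (\<lambda>y. f (l *\<^sub>R y))"
    by (subst (asm) integrable_distr_eq) auto
  have "integral\<^sup>L lborel f = integral\<^sup>L (density (distr lborel borel (\<lambda>x::real^2. 0 + l *\<^sub>R x)) (\<lambda>_. ennreal (\<bar>l\<bar>^DIM(real^2)))) f"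
    by (rule arg_cong[where f = "\<lambda>M. integral\<^sup>L M f", OF eq])
  also have "\<dots> = (LINT x|distr lborel borel (\<lambda>x::real^2. 0 + l *\<^sub>R x). (\<bar>l\<bar>^DIM(real^2)) *\<^sub>R f x)"
    by (rule integral_density) auto
  also have "\<dots> = (LINT x|lborel. (\<bar>l\<bar>^DIM(real^2)) *\<^sub>R f (0 + l *\<^sub>R x))"
    by (rule integral_distr) auto
  also have "\<dots> = l^2 * (LINT y|lborel. f (l *\<^sub>R y))" using l by simp
  finally show "integral\<^sup>L lborel f = l^2 * (LINT y|lborel. f (l *\<^sub>R y))" .
qed

lemma rot_shift:
  "rot (x + axis 1 1) = rot x + axis 2 1" "rot (x + axis 2 1) = rot x + of_int (-1) *\<^sub>R axis 1 1"
  by (simp_all add: vec_eq_iff forall_2 axis_def)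

lemma periodic_rot:
  assumes "periodic f"
  shows "periodic (\<lambda>x. f (rot x))"
proof -
  have "f (rot (x + axis i 1)) = f (rot x)" for x i
  proof -
    consider "i = 1" | "i = 2" using exhaust_2[of i] by blast
    then show ?thesis
    proof cases
      case 1
      then show ?thesis unfolding 1 rot_shift using assms unfolding periodic_def by blast
    next
      case 2
      show ?thesis unfolding 2 rot_shift by (rule periodic_int_shift[OF assms])
    qed
  qed
  then show ?thesis by (simp add: periodic_def)
qed

text \<open>The properties of a periodised mollifier, at a fixed scale, on which the exact formulas
  for the covariances depend.\<close>

definition isotropic_density :: "(real^2 \<Rightarrow> real) \<Rightarrow> bool" where
  "isotropic_density f \<longleftrightarrow> smooth_on UNIV f \<and> periodic f \<and> (\<forall>x. f (rot x) = f x) \<and> torus_integral f = 1"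

lemma rescale_supported:
  assumes "supported_in_square r \<theta>" "l > 0"
  shows "supported_in_square (l * r) (rescale l \<theta>)"
  unfolding supported_in_square_def
proof (intro allI impI)
  fix x :: "real^2" and i assume "l * r < \<bar>x$i\<bar>"
  then have "r < \<bar>(inverse l *\<^sub>R x)$i\<bar>"
    using assms(2) by (simp add: abs_mult field_simps)
  then show "rescale l \<theta> x = 0"
    using supported_in_squareD[OF assms(1)] by (simp add: rescale_def)
qed

lemma mollifier_supp_scale:
  assumes "0 \<le> r" "r < (1/2::real)" "l \<in> {0<..<1}"
  shows "l * r < 1/2"
proof -
  have "l * r \<le> 1 * r" using assms by (intro mult_right_mono) auto
  then show ?thesis using assms by simp
qed

lemma indicator_cell_on_torus:
  assumes "supported_in_square r H" "r < 1/2"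
  shows "indicator cell x *\<^sub>R (on_torus H x * F x) = H x * (F x :: real)"
proof (cases "x \<in> cell")
  case True
  then show ?thesis using on_torus_eq_on_cell[OF assms True] by (simp only: indicator_simps) simp
next
  case False
  then obtain i where "1/2 < \<bar>x$i\<bar>" unfolding cell_iff by (auto simp: not_le)
  then have "H x = 0" using assms by (intro supported_in_squareD[OF assms(1), where i = i]) linarith
  with False show ?thesis by (simp only: indicator_simps) simp
qed

lemma torus_integral_supported:
  fixes H :: "real^2 \<Rightarrow> real"
  assumes "supported_in_square r H" "r < 1/2"
  shows "torus_integral (\<lambda>x. on_torus H x * F x) = (LINT x|lborel. H x * F x)"
  unfolding set_lebesgue_integral_def
  by (intro Bochner_Integration.integral_cong refl indicator_cell_on_torus[OF assms])

lemma radial_mollifier_integrable: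
  assumes "radial_mollifier \<theta>"
  shows "integrable lborel \<theta>"
proof (rule ccontr)
  assume "\<not> ?thesis"
  then have "integral\<^sup>L lborel \<theta> = 0" by (rule not_integrable_integral_eq)
  then show False using radial_mollifierD(3)[OF assms] by simp
qed

lemma isotropic_density_rescale:
  assumes \<theta>: "radial_mollifier \<theta>" and l: "l \<in> {0<..<1}"
  shows "isotropic_density (on_torus (rescale l \<theta>))"
proof -
  obtain r where r: "0 \<le> r" "r < 1/2" "supported_in_square r \<theta>"
    by (rule radial_mollifier_supported[OF \<theta>])
  note s = rescale_supported[OF r(3), of l]
  note lr = mollifier_supp_scale[OF r(1,2) l]
  have l0: "l > 0" using l by simp
  have smooth: "smooth_on UNIV (rescale l \<theta>)"
  proof -
    from smooth_on_affine[OF radial_mollifierD(1)[OF \<theta>], of "inverse (l\<^sup>2)" 0 "inverse l"]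
    show ?thesis by (simp add: rescale_def[abs_def])
  qed
  have rot: "rescale l \<theta> (rot x) = rescale l \<theta> x" for x
  proof -
    have "\<theta> (inverse l *\<^sub>R rot x) = \<theta> (inverse l *\<^sub>R x)"
    proof -
      have "\<forall>x y. norm x = norm y \<longrightarrow> \<theta> x = \<theta> y"
        using \<theta> unfolding radial_mollifier_def by (elim conjE)
      moreover have "norm (inverse l *\<^sub>R rot x) = norm (inverse l *\<^sub>R x)" by simp
      ultimately show ?thesis by (elim allE impE)
    qed
    then show ?thesis by (simp add: rescale_def)
  qed
  have "on_torus (rescale l \<theta>) (rot x) = on_torus (rescale l \<theta>) x" for x
  proof (rule periodic_eqI[OF periodic_rot[OF periodic_on_torus] periodic_on_torus])
    fix x :: "real^2" assume x: "x \<in> cell"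
    then have x': "rot x \<in> cell" by (simp only: rot_cell)
    show "on_torus (rescale l \<theta>) (rot x) = on_torus (rescale l \<theta>) x"
      unfolding on_torus_eq_on_cell[OF s[OF l0] lr x] on_torus_eq_on_cell[OF s[OF l0] lr x'] by (rule rot)
  qed
  moreover have "torus_integral (on_torus (rescale l \<theta>)) = 1"
  proof -
    have i: "integrable lborel (\<lambda>x. \<theta> (inverse l *\<^sub>R x))"
      "integral\<^sup>L lborel \<theta> = (inverse l)^2 * (LINT y|lborel. \<theta> (inverse l *\<^sub>R y))"
      using integral_rescale[of "inverse l" \<theta>] l0 radial_mollifier_integrable[OF \<theta>] by auto
    have "torus_integral (on_torus (rescale l \<theta>)) = (LINT x|lborel. rescale l \<theta> x)"
      using torus_integral_supported[OF s[OF l0] lr, of "\<lambda>_. 1"] by simp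
    also have "\<dots> = (inverse l)^2 * (LINT y|lborel. \<theta> (inverse l *\<^sub>R y))"
      by (simp add: rescale_def power_inverse)
    also have "\<dots> = 1" unfolding i(2)[symmetric] by (rule radial_mollifierD(3)[OF \<theta>])
    finally show ?thesis .
  qed
  ultimately show ?thesis
    using smooth_on_on_torus[OF s[OF l0] lr smooth] periodic_on_torus
    unfolding isotropic_density_def by blast
qed

section \<open>Green potentials and the velocity field\<close>

lemma green_functionD:
  assumes "green_function G"
  shows "periodic G" "set_integrable lborel cell G" "torus_integral G = 0"
    "\<And>\<phi>. smooth_on UNIV \<phi> \<Longrightarrow> periodic \<phi> \<Longrightarrow>
        torus_integral (\<lambda>x. G x * (- laplacian \<phi> x)) = \<phi> 0 - torus_integral \<phi>"
  using assms unfolding green_function_def by (elim conjE, blast)+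

text \<open>Derivatives of \<open>G * f\<close> fall on \<open>f\<close>, so the Laplacian of \<open>G * f\<close> at \<open>a\<close> is the pairing of \<open>G\<close>
  with the Laplacian of the test function \<open>x \<mapsto> f (a - x)\<close>; the distributional equation for \<open>G\<close>
  evaluates it. The mean is the product of the means of \<open>f\<close> and \<open>G\<close>.\<close>

lemma green_potential:
  assumes G: "green_function G" and f: "smooth_on UNIV f" "periodic f"
  shows "tconv G f = tconv f G"
    and "periodic (tconv G f)" "smooth_on UNIV (tconv G f)" "torus_integral (tconv G f) = 0"
    and "laplacian (tconv G f) a = torus_integral f - f a"
proof -
  note G' = green_functionD[OF G]
  note cf = smooth_on_continuous[OF f(1)]
  note df = smooth_on_differentiable[OF f(1)]
  have C1: "Ck_on 1 UNIV f" "Ck_on 1 UNIV (pderiv_dir i f)" for i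
    using f(1) smooth_on_pderiv_dir[OF f(1)] unfolding smooth_on_def by blast+
  show eq: "tconv G f = tconv f G" by (rule tconv_commute[OF G'(1,2) f(2) cf])
  show "periodic (tconv G f)" unfolding eq by (rule periodic_tconv[OF f(2)])
  show "smooth_on UNIV (tconv G f)"
    unfolding eq smooth_on_def using Ck_on_tconv[OF f(2) _ G'(2)] f(1) unfolding smooth_on_def by blast
  show "torus_integral (tconv G f) = 0"
    unfolding eq torus_integral_tconv[OF f(2) cf G'(2)] G'(3) by simp
  have p: "periodic (pderiv_dir i f)" for i by (rule periodic_pderiv_dir[OF f(2) df])
  have second: "pderiv_dir i (pderiv_dir i (tconv f G)) = tconv (pderiv_dir i (pderiv_dir i f)) G" for i
    unfolding pderiv_dir_tconv[OF f(2) C1(1) G'(2)] by (rule pderiv_dir_tconv[OF p C1(2) G'(2)])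
  let ?v = "\<lambda>x. 1 *\<^sub>R f (a + (-1) *\<^sub>R x)"
  have sv: "smooth_on UNIV ?v" by (rule smooth_on_affine[OF f(1)])
  have pv: "periodic ?v"
  proof -
    have "f (a - (x + axis i 1) + axis i 1) = f (a - (x + axis i 1))" for x i
      using f(2) unfolding periodic_def by blast
    then show ?thesis by (simp add: periodic_def)
  qed
  have "pderiv_dir i (pderiv_dir i ?v) x = pderiv_dir i (pderiv_dir i f) (a - x)" for i x
    unfolding pderiv_dir_affine(2)[OF df]
      pderiv_dir_affine(2)[OF smooth_on_differentiable[OF smooth_on_pderiv_dir[OF f(1)]]] by simp
  then have lv: "laplacian ?v x = laplacian f (a - x)" for x
    by (simp add: laplacian_def)
  have "torus_integral (\<lambda>x. G x * (- laplacian ?v x)) = ?v 0 - torus_integral ?v"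
    by (rule G'(4)[OF sv pv])
  also have "torus_integral ?v = torus_integral f"
    using torus_reflect(2)[OF f(2) continuous_torus_integrable[OF cf], of a] by simp
  finally have w: "torus_integral (\<lambda>x. G x * (- laplacian f (a - x))) = f a - torus_integral f"
    unfolding lv by simp
  have c2: "continuous_on UNIV (pderiv_dir i (pderiv_dir i f))" for i
    by (rule Ck_on_1D(2)[OF C1(2)])
  have p2: "periodic (pderiv_dir i (pderiv_dir i f))" for i
    by (rule periodic_pderiv_dir[OF p Ck_on_1D(1)[OF C1(2)]])
  note int = tconv_integrable[OF p2 c2 G'(2)]
  have "laplacian (tconv G f) a = tconv (pderiv_dir 1 (pderiv_dir 1 f)) G a + tconv (pderiv_dir 2 (pderiv_dir 2 f)) G a"
    unfolding laplacian_2 eq second ..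
  also have "\<dots> = torus_integral (\<lambda>x. G x *\<^sub>R pderiv_dir 1 (pderiv_dir 1 f) (a - x) + G x *\<^sub>R pderiv_dir 2 (pderiv_dir 2 f) (a - x))"
    unfolding tconv_def by (rule set_integral_add(2)[OF int int, symmetric])
  also have "\<dots> = torus_integral (\<lambda>x. - (G x * (- laplacian f (a - x))))"
    by (simp add: laplacian_2 algebra_simps)
  also have "\<dots> = torus_integral f - f a"
    using w by (simp add: set_lebesgue_integral_def)
  finally show "laplacian (tconv G f) a = torus_integral f - f a" .
qed

text \<open>The difference of the two sides has zero divergence and zero curl. By the
  Cauchy--Riemann type relations between its components, these are harmonic, hence constant, and
  they have mean zero.\<close>

lemma biot_savart_eq_rotated_gradient:
  assumes G: "green_function G" and K: "biot_savart_kernel K" and f: "smooth_on UNIV f" "periodic f"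
  shows "tconv K f x = vector [- pderiv_dir 2 (tconv G f) x, pderiv_dir 1 (tconv G f) x]"
proof -
  define \<phi> where "\<phi> = tconv G f"
  define u where "u = tconv K f"
  have \<phi>: "periodic \<phi>" "smooth_on UNIV \<phi>" "\<And>a. laplacian \<phi> a = torus_integral f - f a"
    unfolding \<phi>_def by (fact green_potential[OF G f])+
  have u: "smooth_on UNIV u" "torus_integral u = 0" "\<And>x. divergence u x = 0"
    "\<And>x. perp_div u x = f x - torus_integral f"
    using K[unfolded biot_savart_kernel_def, THEN conjunct2, THEN conjunct2, THEN spec[of _ f]] f
    unfolding u_def by blast+
  have pu: "periodic u"
  proof -
    have "K (a + axis i 1 - x) = K (a - x)" for a x i
    proof -
      have "K (a - x + axis i 1) = K (a - x)"
        using K[unfolded biot_savart_kernel_def periodic_def, THEN conjunct1] by blast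
      then show ?thesis by (simp add: diff_add_eq)
    qed
    then show ?thesis unfolding u_def periodic_def tconv_def by simp
  qed
  note sp = smooth_on_pderiv_dir[OF \<phi>(2)]
  note d1 = smooth_on_differentiable[OF sp]
  have C2: "Ck_on 2 UNIV (pderiv_dir i \<phi>)" for i by (rule Ck_on_2_smooth[OF sp])
  have pp: "periodic (pderiv_dir i \<phi>)" for i
    by (rule periodic_pderiv_dir[OF \<phi>(1) smooth_on_differentiable[OF \<phi>(2)]])
  have u_sm: "Ck_on k UNIV (\<lambda>x. u x $ i)" for k i
    using u(1) by (intro Ck_on_vec_nth) (simp only: smooth_on_def)
  have du: "(\<lambda>x. u x $ i) differentiable (at x)" for i x
    by (rule Ck_on_1D(1)[OF u_sm])
  define w1 where "w1 = (\<lambda>x. u x $ 1 + pderiv_dir 2 \<phi> x)"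
  define w2 where "w2 = (\<lambda>x. u x $ 2 + - pderiv_dir 1 \<phi> x)"
  have dm: "(\<lambda>x. - pderiv_dir 1 \<phi> x) differentiable (at x)" for x
    by (intro differentiable_minus d1)
  have w1': "pderiv_dir i w1 x = pderiv_dir i (\<lambda>x. u x $ 1) x + pderiv_dir i (pderiv_dir 2 \<phi>) x" for i x
    unfolding w1_def by (rule pderiv_dir_add[OF du d1])
  have w2': "pderiv_dir i w2 x = pderiv_dir i (\<lambda>x. u x $ 2) x + - pderiv_dir i (pderiv_dir 1 \<phi>) x" for i x
    unfolding w2_def pderiv_dir_add[OF du dm] pderiv_dir_minus[OF d1] ..
  have Cw: "Ck_on 2 UNIV w1" "Ck_on 2 UNIV w2"
    unfolding w1_def w2_def by (intro Ck_on_add Ck_on_minus u_sm C2)+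
  have pw: "periodic w1" "periodic w2"
    using pu pp unfolding w1_def w2_def periodic_def by simp_all
  have div: "pderiv_dir 1 w1 x = - pderiv_dir 2 w2 x" for x
    using u(3)[of x] pderiv_dir_commute[OF Ck_on_2_smooth[OF \<phi>(2)], of 1 2 x]
    by (simp add: w1' w2' divergence_def sum_2)
  have curl: "pderiv_dir 2 w1 x = pderiv_dir 1 w2 x" for x
    using u(4)[of x] \<phi>(3)[of x] by (simp add: w1' w2' perp_div_def laplacian_2)
  note dw = Ck_on_1D(1)[OF Ck_on_2D(2)[OF Cw(1)]] Ck_on_1D(1)[OF Ck_on_2D(2)[OF Cw(2)]]
  have divf: "pderiv_dir 1 w1 = (\<lambda>x. - pderiv_dir 2 w2 x)" "pderiv_dir 2 w2 = (\<lambda>x. - pderiv_dir 1 w1 x)"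
    and curlf: "pderiv_dir 2 w1 = pderiv_dir 1 w2"
    using div curl by auto
  have "laplacian w1 x = 0" for x
  proof -
    have "pderiv_dir 1 (pderiv_dir 1 w1) x = - pderiv_dir 1 (pderiv_dir 2 w2) x"
      unfolding divf(1) by (rule pderiv_dir_minus[OF dw(2)])
    then show ?thesis
      unfolding laplacian_2 curlf using pderiv_dir_commute[OF Cw(2), of 1 2 x] by simp
  qed
  moreover have "laplacian w2 x = 0" for x
  proof -
    have "pderiv_dir 2 (pderiv_dir 2 w2) x = - pderiv_dir 2 (pderiv_dir 1 w1) x"
      unfolding divf(2) by (rule pderiv_dir_minus[OF dw(1)])
    then show ?thesis
      unfolding laplacian_2 curlf[symmetric] using pderiv_dir_commute[OF Cw(1), of 1 2 x] by simp
  qed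
  ultimately have const: "w1 x = w1 y" "w2 x = w2 y" for x y
    using periodic_harmonic_constant[OF pw(1) Cw(1)] periodic_harmonic_constant[OF pw(2) Cw(2)] by blast+
  have iu: "set_integrable lborel cell u"
    by (rule continuous_torus_integrable[OF smooth_on_continuous[OF u(1)]])
  have mean_u: "torus_integral (\<lambda>x. u x $ i) = 0" for i
  proof -
    have "torus_integral (\<lambda>x. u x $ i) = torus_integral u $ i"
      using integral_bounded_linear[OF bounded_linear_vec_nth iu[unfolded set_integrable_def], of i]
      by (simp add: set_lebesgue_integral_def)
    then show ?thesis unfolding u(2) by simp
  qed
  have mean_\<phi>: "torus_integral (pderiv_dir i \<phi>) = 0" for i
    by (rule torus_integral_pderiv_dir[OF \<phi>(1) Ck_on_2D(1)[OF Ck_on_2_smooth[OF \<phi>(2)]]])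
  note iu' = continuous_torus_integrable[OF Ck_on_1D(3)[OF u_sm]]
  note ip = continuous_torus_integrable[OF smooth_on_continuous[OF sp]]
  have "torus_integral w1 = 0"
    unfolding w1_def set_integral_add(2)[OF iu' ip] mean_u mean_\<phi> by simp
  moreover have "torus_integral w1 = w1 x"
  proof -
    have "w1 = (\<lambda>_. w1 x)" by (rule ext) (rule const(1))
    then show ?thesis by (rule trans[OF arg_cong[where f = "\<lambda>F. torus_integral F"] torus_integral_const])
  qed
  moreover have "torus_integral w2 = 0"
  proof -
    have "torus_integral w2 = torus_integral (\<lambda>x. u x $ 2) - torus_integral (pderiv_dir 1 \<phi>)"
      unfolding w2_def set_integral_diff(2)[OF iu' ip, symmetric] by simp
    then show ?thesis unfolding mean_u mean_\<phi> by simp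
  qed
  moreover have "torus_integral w2 = w2 x"
  proof -
    have "w2 = (\<lambda>_. w2 x)" by (rule ext) (rule const(2))
    then show ?thesis by (rule trans[OF arg_cong[where f = "\<lambda>F. torus_integral F"] torus_integral_const])
  qed
  ultimately have "w1 x = 0" "w2 x = 0" by simp_all
  then show ?thesis
    unfolding \<phi>_def[symmetric] u_def[symmetric] w1_def w2_def
    by (simp add: vec_eq_iff forall_2 vector_2)
qed

lemma pderiv_dir_rot:
  assumes "\<And>x. F differentiable (at x)"
  shows "pderiv_dir 1 (\<lambda>x. F (rot x)) x = pderiv_dir 2 F (rot x)"
    and "pderiv_dir 2 (\<lambda>x. F (rot x)) x = - pderiv_dir 1 F (rot x)"
proof -
  have "(F has_derivative frechet_derivative F (at (rot x))) (at (rot x))"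
    using assms by (simp add: frechet_derivative_works[symmetric])
  then have D: "((\<lambda>x. F (rot x)) has_derivative (\<lambda>h. frechet_derivative F (at (rot x)) (rot h))) (at x)"
    by (rule has_derivative_compose[rotated])
      (rule bounded_linear.has_derivative[OF bounded_linear_rot has_derivative_ident])
  have lin: "linear (frechet_derivative F (at (rot x)))" using assms by (rule linear_frechet_derivative)
  have r: "rot (axis 1 1) = axis 2 1" "rot (axis 2 1) = (-1) *\<^sub>R axis 1 1"
    by (simp_all add: vec_eq_iff forall_2 axis_def)
  show "pderiv_dir 1 (\<lambda>x. F (rot x)) x = pderiv_dir 2 F (rot x)"
    "pderiv_dir 2 (\<lambda>x. F (rot x)) x = - pderiv_dir 1 F (rot x)"
    unfolding pderiv_dir_eq[OF D] r by (simp_all add: pderiv_dir_def linear_neg[OF lin])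
qed

lemma isotropic_densityD:
  assumes "isotropic_density f"
  shows "smooth_on UNIV f" "periodic f" "f (rot x) = f x" "f (- x) = f x" "torus_integral f = 1"
proof -
  have r: "\<And>x. f (rot x) = f x" using assms by (simp only: isotropic_density_def)
  then have "f (rot (rot x)) = f x" by (simp only:)
  then show "f (- x) = f x" by (simp only: rot_rot)
qed (use assms in \<open>simp_all only: isotropic_density_def\<close>)

text \<open>The difference of the two sides is harmonic because \<open>f\<close> is invariant, hence constant,
  and it vanishes at the fixed point 0 of the rotation.\<close>

lemma green_potential_rot:
  assumes G: "green_function G" and f: "isotropic_density f"
  shows "tconv G f (rot x) = tconv G f x"
proof -
  note f' = isotropic_densityD[OF f]
  note \<phi> = green_potential[OF G f'(1,2)]
  let ?p = "tconv G f"
  note d0 = smooth_on_differentiable[OF \<phi>(3)]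
  note d1 = smooth_on_differentiable[OF smooth_on_pderiv_dir[OF \<phi>(3)]]
  define w where "w = (\<lambda>x. ?p (rot x) + - ?p x)"
  have rd: "(\<lambda>x. F (rot x)) differentiable (at x)" if "\<And>x. F differentiable (at x)" for F :: "real^2 \<Rightarrow> real" and x
    using differentiable_chain_at[of rot x F] that bounded_linear_imp_differentiable[OF bounded_linear_rot]
    by (simp add: o_def)
  have dm: "(\<lambda>x. - F x) differentiable (at x)" if "\<And>x. F differentiable (at x)" for F :: "real^2 \<Rightarrow> real" and x
    by (intro differentiable_minus that)
  have w1: "pderiv_dir 1 w = (\<lambda>x. pderiv_dir 2 ?p (rot x) + - pderiv_dir 1 ?p x)"
    unfolding w_def
    by (rule ext) (simp only: pderiv_dir_add[OF rd[OF d0] dm[OF d0]] pderiv_dir_minus[OF d0] pderiv_dir_rot[OF d0])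
  have w2: "pderiv_dir 2 w = (\<lambda>x. - pderiv_dir 1 ?p (rot x) + - pderiv_dir 2 ?p x)"
    unfolding w_def
    by (rule ext) (simp only: pderiv_dir_add[OF rd[OF d0] dm[OF d0]] pderiv_dir_minus[OF d0] pderiv_dir_rot[OF d0])
  have w11: "pderiv_dir 1 (pderiv_dir 1 w) = (\<lambda>x. pderiv_dir 2 (pderiv_dir 2 ?p) (rot x) + - pderiv_dir 1 (pderiv_dir 1 ?p) x)"
    unfolding w1
    by (rule ext) (simp only: pderiv_dir_add[OF rd[OF d1] dm[OF d1]] pderiv_dir_minus[OF d1] pderiv_dir_rot[OF d1])
  have w21: "pderiv_dir 2 (pderiv_dir 1 w) = (\<lambda>x. - pderiv_dir 1 (pderiv_dir 2 ?p) (rot x) + - pderiv_dir 2 (pderiv_dir 1 ?p) x)"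
    unfolding w1
    by (rule ext) (simp only: pderiv_dir_add[OF rd[OF d1] dm[OF d1]] pderiv_dir_minus[OF d1] pderiv_dir_rot[OF d1])
  have w12: "pderiv_dir 1 (pderiv_dir 2 w) = (\<lambda>x. - pderiv_dir 2 (pderiv_dir 1 ?p) (rot x) + - pderiv_dir 1 (pderiv_dir 2 ?p) x)"
    unfolding w2
    by (rule ext) (simp only: pderiv_dir_add[OF dm[OF rd[OF d1]] dm[OF d1]] pderiv_dir_minus[OF d1] pderiv_dir_minus[OF rd[OF d1]] pderiv_dir_rot[OF d1])
  have w22: "pderiv_dir 2 (pderiv_dir 2 w) = (\<lambda>x. - (- pderiv_dir 1 (pderiv_dir 1 ?p) (rot x)) + - pderiv_dir 2 (pderiv_dir 2 ?p) x)"
    unfolding w2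
    by (rule ext) (simp only: pderiv_dir_add[OF dm[OF rd[OF d1]] dm[OF d1]] pderiv_dir_minus[OF d1] pderiv_dir_minus[OF rd[OF d1]] pderiv_dir_rot[OF d1])
  have crot: "continuous_on UNIV (\<lambda>x. F (rot x))" if "continuous_on UNIV F" for F :: "real^2 \<Rightarrow> real"
    by (rule continuous_on_compose2[OF that]) (auto intro: linear_continuous_on bounded_linear_rot)
  have c2: "continuous_on UNIV (pderiv_dir i (pderiv_dir j ?p))" for i j
    by (intro smooth_on_continuous smooth_on_pderiv_dir \<phi>(3))
  have "Ck_on 2 UNIV w"
  proof -
    have dw: "w differentiable (at x)" for x
      unfolding w_def by (intro differentiable_add rd dm d0)
    have dw1: "pderiv_dir i w differentiable (at x)" for i x
    proof -
      consider "i = 1" | "i = 2" using exhaust_2[of i] by blast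
      then show ?thesis
        by cases (auto simp only: w1 w2 intro!: differentiable_add rd dm d1)
    qed
    have cw: "continuous_on UNIV (pderiv_dir i (pderiv_dir j w))" for i j
    proof -
      consider "i = 1" "j = 1" | "i = 1" "j = 2" | "i = 2" "j = 1" | "i = 2" "j = 2"
        using exhaust_2[of i] exhaust_2[of j] by blast
      then show ?thesis
        by cases (auto simp only: w11 w12 w21 w22 intro!: continuous_intros crot c2)
    qed
    show ?thesis unfolding numeral_2_eq_2 Ck_on.simps using dw dw1 cw by blast
  qed
  moreover have "periodic w"
    using periodic_rot[OF \<phi>(2)] \<phi>(2) unfolding w_def periodic_def by simp
  moreover have "laplacian w x = 0" for x
  proof -
    have "laplacian w x = laplacian ?p (rot x) - laplacian ?p x"
      unfolding laplacian_2 w11 w22 by simp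
    then show ?thesis unfolding \<phi>(5) f'(3) by simp
  qed
  ultimately have "w x = w 0" using periodic_harmonic_constant[of w x 0] by blast
  moreover have "rot 0 = 0" by (simp add: vec_eq_iff forall_2)
  ultimately show ?thesis by (simp add: w_def)
qed

text \<open>The electrostatic interaction energy \<open>\<integral>\<integral> G (x - y) g y f x dy dx\<close>.\<close>

definition interaction :: "(real^2 \<Rightarrow> real) \<Rightarrow> (real^2 \<Rightarrow> real) \<Rightarrow> (real^2 \<Rightarrow> real) \<Rightarrow> real" where
  "interaction G g f = torus_integral (\<lambda>x. tconv G g x * f x)"

text \<open>Invariance under the quarter turn makes the diagonal moments equal and the two mixed
  ones opposite to each other; the mixed ones are also equal, because mixed derivatives commute,
  and so vanish. The trace is the integral of \<open>(G * g) x\<close> against the Laplacian of \<open>G * f\<close> at \<open>- x\<close>,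
  which is \<open>1 - f x\<close> by Poisson's equation and evenness; the constant 1 contributes nothing since
  \<open>G * g\<close> has zero mean.\<close>

lemma second_moments_of_potential:
  assumes G: "green_function G" and f: "isotropic_density f" and g: "isotropic_density g"
  shows "torus_integral (\<lambda>x. tconv G g x * pderiv_dir i (pderiv_dir j (tconv G f)) (- x))
    = (if i = j then - (interaction G g f) / 2 else 0)"
proof -
  define \<phi> where "\<phi> = tconv G f"
  define \<psi> where "\<psi> = tconv G g"
  note f' = isotropic_densityD[OF f]
  note g' = isotropic_densityD[OF g]
  note p\<phi> = green_potential[OF G f'(1,2), folded \<phi>_def]
  note p\<psi> = green_potential[OF G g'(1,2), folded \<psi>_def]
  note r\<phi> = green_potential_rot[OF G f, folded \<phi>_def]
  note r\<psi> = green_potential_rot[OF G g, folded \<psi>_def]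
  note d0 = smooth_on_differentiable[OF p\<phi>(3)]
  note d1 = smooth_on_differentiable[OF smooth_on_pderiv_dir[OF p\<phi>(3)]]
  let ?M = "\<lambda>i j. torus_integral (\<lambda>x. \<psi> x * pderiv_dir i (pderiv_dir j \<phi>) (- x))"
  have p1: "pderiv_dir 1 \<phi> = (\<lambda>x. pderiv_dir 2 \<phi> (rot x))"
    using pderiv_dir_rot(1)[OF d0] unfolding r\<phi> by blast
  have p11: "pderiv_dir 1 (pderiv_dir 1 \<phi>) x = pderiv_dir 2 (pderiv_dir 2 \<phi>) (rot x)" for x
    by (subst p1) (rule pderiv_dir_rot(1)[OF d1])
  have p21: "pderiv_dir 2 (pderiv_dir 1 \<phi>) x = - pderiv_dir 1 (pderiv_dir 2 \<phi>) (rot x)" for x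
    by (subst p1) (rule pderiv_dir_rot(2)[OF d1])
  have p12: "pderiv_dir 1 (pderiv_dir 2 \<phi>) = pderiv_dir 2 (pderiv_dir 1 \<phi>)"
    using pderiv_dir_commute[OF Ck_on_2_smooth[OF p\<phi>(3)]] by blast
  have c\<psi>: "continuous_on UNIV \<psi>" by (rule smooth_on_continuous[OF p\<psi>(3)])
  have c: "continuous_on UNIV (\<lambda>x. \<psi> x * pderiv_dir i (pderiv_dir j \<phi>) (- x))" for i j
  proof -
    have "continuous_on UNIV (pderiv_dir i (pderiv_dir j \<phi>))"
      by (intro smooth_on_continuous smooth_on_pderiv_dir p\<phi>(3))
    from continuous_reflect[OF this, of 0] show ?thesis
      by (intro continuous_intros c\<psi>) simp
  qed
  note int = continuous_torus_integrable[OF c]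
  have rm: "rot (- x) = - rot x" for x by (simp add: vec_eq_iff forall_2)
  have M11: "?M 1 1 = ?M 2 2"
    using torus_rot(2)[OF int, of 2 2] unfolding r\<psi> p11 rm .
  have M21: "?M 2 1 = - ?M 1 2"
  proof -
    have "?M 2 1 = torus_integral (\<lambda>x. - (\<psi> (rot x) * pderiv_dir 1 (pderiv_dir 2 \<phi>) (- rot x)))"
      unfolding p21 rm r\<psi> by simp
    also have "\<dots> = - torus_integral (\<lambda>x. \<psi> (rot x) * pderiv_dir 1 (pderiv_dir 2 \<phi>) (- rot x))"
      by (simp add: set_lebesgue_integral_def)
    finally show ?thesis unfolding torus_rot(2)[OF int, of 1 2] .
  qed
  have M12: "?M 1 2 = 0" "?M 2 1 = 0" using M21 unfolding p12 by simp_all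
  have "?M 1 1 + ?M 2 2 = torus_integral (\<lambda>x. \<psi> x * laplacian \<phi> (- x))"
    unfolding laplacian_2 distrib_left by (rule set_integral_add(2)[OF int int, symmetric])
  also have "\<dots> = torus_integral (\<lambda>x. \<psi> x - \<psi> x * f x)"
    unfolding p\<phi>(5) f'(4,5) by (simp add: algebra_simps)
  also have "\<dots> = torus_integral \<psi> - torus_integral (\<lambda>x. \<psi> x * f x)"
    by (intro set_integral_diff(2) continuous_torus_integrable continuous_intros c\<psi> smooth_on_continuous f'(1))
  finally have "?M 1 1 + ?M 2 2 = - interaction G g f"
    unfolding p\<psi>(4) interaction_def \<psi>_def[symmetric] by simp
  with M11 have "?M 1 1 = - interaction G g f / 2" "?M 2 2 = - interaction G g f / 2" by simp_all
  with M12 show ?thesis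
    unfolding \<phi>_def[symmetric] \<psi>_def[symmetric] using exhaust_2[of i] exhaust_2[of j] by auto
qed

lemma dirichlet_pairing:
  assumes G: "green_function G" and f: "smooth_on UNIV f" "periodic f" "torus_integral f = 1"
    and v: "smooth_on UNIV v" "periodic v"
  shows "torus_integral (\<lambda>x. pderiv_dir 1 (tconv G f) x * pderiv_dir 1 v x + pderiv_dir 2 (tconv G f) x * pderiv_dir 2 v x)
    = torus_integral (\<lambda>x. f x * v x) - torus_integral v"
proof -
  note \<phi> = green_potential[OF G f(1,2)]
  have v1: "Ck_on 1 UNIV v" using v(1) by (simp only: smooth_on_def)
  note cv = smooth_on_continuous[OF v(1)] and cf = smooth_on_continuous[OF f(1)]
  have "torus_integral (\<lambda>x. laplacian (tconv G f) x * v x) = torus_integral (\<lambda>x. v x - f x * v x)"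
    unfolding \<phi>(5) f(3) by (simp add: algebra_simps)
  also have "\<dots> = torus_integral v - torus_integral (\<lambda>x. f x * v x)"
    by (intro set_integral_diff(2) continuous_torus_integrable continuous_intros cv cf)
  finally show ?thesis
    unfolding green_identity[OF \<phi>(2) Ck_on_2_smooth[OF \<phi>(3)] v(2) v1] by simp
qed

text \<open>The velocity \<open>K * f\<close> has the length of the gradient of \<open>\<phi> = G * f\<close>, so its squared norm
  is the Dirichlet pairing of \<open>\<phi>\<close> with itself, and \<open>\<phi>\<close> has zero mean.\<close>

lemma torus_L2norm_biot_savart:
  assumes G: "green_function G" and K: "biot_savart_kernel K" and f: "isotropic_density f"
  shows "torus_L2norm (tconv K f) = sqrt (interaction G f f)"
proof -
  note f' = isotropic_densityD[OF f]
  note \<phi> = green_potential[OF G f'(1,2)]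
  have "(norm (tconv K f x))\<^sup>2 = pderiv_dir 1 (tconv G f) x * pderiv_dir 1 (tconv G f) x
      + pderiv_dir 2 (tconv G f) x * pderiv_dir 2 (tconv G f) x" for x
    unfolding biot_savart_eq_rotated_gradient[OF G K f'(1,2)] norm_vec_def L2_set_def
    by (simp add: sum_2 vector_2 power2_eq_square)
  then have "torus_integral (\<lambda>x. (norm (tconv K f x))\<^sup>2) = interaction G f f"
    using dirichlet_pairing[OF G f'(1,2,5) \<phi>(3,2)] unfolding \<phi>(4) interaction_def
    by (simp add: mult.commute)
  then show ?thesis by (simp only: torus_L2norm_def)
qed

section \<open>The logarithmic size of the interaction energies\<close>

text \<open>Undoing the dilation of the mollifier moves the scale into the argument of \<open>G\<close>, where
  the logarithm turns it into an additive term.\<close>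

lemma potential_unscaled:
  assumes G: "green_function G" and \<theta>: "radial_mollifier \<theta>" and l: "l \<in> {0<..<1}"
  shows "integrable lborel (\<lambda>y. \<theta> y * G (a - l *\<^sub>R y))"
    and "tconv G (on_torus (rescale l \<theta>)) a = (LINT y|lborel. \<theta> y * G (a - l *\<^sub>R y))"
proof -
  obtain r where r: "0 \<le> r" "r < 1/2" "supported_in_square r \<theta>"
    by (rule radial_mollifier_supported[OF \<theta>])
  have l0: "l > 0" using l by simp
  note s = rescale_supported[OF r(3) l0]
  note lr = mollifier_supp_scale[OF r(1,2) l]
  note G' = green_functionD[OF G]
  note f = isotropic_densityD[OF isotropic_density_rescale[OF \<theta> l]]
  let ?f = "on_torus (rescale l \<theta>)"
  have p: "?f (a - (x + axis i 1)) = ?f (a - x)" for x i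
  proof -
    have "?f (a - (x + axis i 1) + axis i 1) = ?f (a - (x + axis i 1))"
      using f(2) unfolding periodic_def by blast
    then show ?thesis by simp
  qed
  have "periodic (\<lambda>x. G x *\<^sub>R ?f (a - x))" using G'(1) p by (simp add: periodic_def)
  from torus_reflect(1)[OF this tconv_integrable[OF f(2) smooth_on_continuous[OF f(1)] G'(2)], of a]
  have "integrable lborel (\<lambda>x. indicator cell x *\<^sub>R (?f x * G (a - x)))"
    unfolding set_integrable_def by (simp add: mult.commute)
  then have i: "integrable lborel (\<lambda>x. rescale l \<theta> x * G (a - x))"
    unfolding indicator_cell_on_torus[OF s lr, where F = "\<lambda>x. G (a - x)"] .
  have e: "rescale l \<theta> (l *\<^sub>R y) * G (a - l *\<^sub>R y) = inverse (l^2) * (\<theta> y * G (a - l *\<^sub>R y))" for y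
    using l0 by (simp add: rescale_def)
  show "integrable lborel (\<lambda>y. \<theta> y * G (a - l *\<^sub>R y))"
    using integral_rescale(1)[OF l0 i] l0 unfolding e by simp
  have "tconv G ?f a = (LINT x|lborel. rescale l \<theta> x * G (a - x))"
    unfolding tconv_def using torus_integral_supported[OF s lr, of "\<lambda>x. G (a - x)"] by simp
  also have "\<dots> = l^2 * (LINT y|lborel. inverse (l^2) * (\<theta> y * G (a - l *\<^sub>R y)))"
    unfolding integral_rescale(2)[OF l0 i] e ..
  also have "\<dots> = (LINT y|lborel. \<theta> y * G (a - l *\<^sub>R y))" using l0 by simp
  finally show "tconv G ?f a = (LINT y|lborel. \<theta> y * G (a - l *\<^sub>R y))" .
qed

lemma norm_le_1_on_cell:
  assumes "x \<in> cell"
  shows "norm x \<le> 1"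
proof -
  have "\<bar>x$1\<bar> \<le> 1/2" "\<bar>x$2\<bar> \<le> 1/2" using assms unfolding cell_iff by blast+
  then show ?thesis using norm_le_l1_cart[of x] by (simp add: sum_2)
qed

text \<open>Near 0 one has \<open>G (l z) = - (ln l + ln \<bar>z\<bar>) / (2 \<pi>) + h (l z)\<close> with \<open>h\<close> bounded. In the
  difference of two scales at the same \<open>z\<close> the singular term \<open>ln \<bar>z\<bar>\<close> cancels, so that the
  logarithmic growth in \<open>l\<close> is obtained without integrating a logarithm.\<close>

lemma potential_compare_scales:
  assumes G: "green_function G" and \<theta>: "radial_mollifier \<theta>"
  obtains l1 H where "0 < l1" "l1 < 1"
    "\<forall>l a. 0 < l \<longrightarrow> l \<le> l1 \<longrightarrow> a \<in> cell \<longrightarrow>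
      \<bar>tconv G (on_torus (rescale l \<theta>)) (l *\<^sub>R a) - tconv G (on_torus (rescale l1 \<theta>)) (l1 *\<^sub>R a)
        + (ln l - ln l1) / (2 * pi)\<bar> \<le> 2 * H"
proof -
  have "\<exists>r>0. \<exists>h. smooth_on (ball 0 r) h \<and> (\<forall>x\<in>ball 0 r - {0}. G x + ln (norm x) / (2 * pi) = h x)"
    using G unfolding green_function_def by (elim conjE)
  then obtain R h where R: "R > 0" and h: "smooth_on (ball 0 R) h"
    and Gh: "\<forall>x\<in>ball 0 R - {0}. G x + ln (norm x) / (2 * pi) = h x"
    by blast
  have "Ck_on 0 (ball 0 R) h" using h unfolding smooth_on_def by blast
  then have "continuous_on (cball 0 (R/2)) h"
    using R by (auto intro: continuous_on_subset)
  then have "compact (h ` cball 0 (R/2))" by (intro compact_continuous_image) auto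
  then obtain H where H: "\<And>x. x \<in> cball 0 (R/2) \<Longrightarrow> \<bar>h x\<bar> \<le> H"
    by (metis compact_imp_bounded bounded_iff imageI real_norm_def)
  \<comment> \<open>Points of the cell have distance at most 2 from each other, so up to scale \<open>R / 4\<close> all
    arguments of \<open>h\<close> stay in the ball of radius \<open>R / 2\<close>.\<close>
  define l1 where "l1 = min (1/2) (R/4)"
  have l1: "0 < l1" "l1 < 1" "2 * l1 \<le> R / 2" using R by (auto simp: l1_def)
  obtain r where r: "0 \<le> r" "r < 1/2" "supported_in_square r \<theta>"
    by (rule radial_mollifier_supported[OF \<theta>])
  have "\<bar>tconv G (on_torus (rescale l \<theta>)) (l *\<^sub>R a) - tconv G (on_torus (rescale l1 \<theta>)) (l1 *\<^sub>R a)
      + (ln l - ln l1) / (2 * pi)\<bar> \<le> 2 * H"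
    if l: "0 < l" "l \<le> l1" and a: "a \<in> cell" for l a
  proof -
    let ?c = "(ln l - ln l1) / (2 * pi)"
    have l01: "l \<in> {0<..<1}" "l1 \<in> {0<..<1}" using l l1 by auto
    note P = potential_unscaled[OF G \<theta>]
    have i1: "integrable lborel (\<lambda>y. \<theta> y * G (l *\<^sub>R a - l *\<^sub>R y))" by (rule P(1)[OF l01(1)])
    have i2: "integrable lborel (\<lambda>y. \<theta> y * G (l1 *\<^sub>R a - l1 *\<^sub>R y))" by (rule P(1)[OF l01(2)])
    have i3: "integrable lborel \<theta>" by (rule radial_mollifier_integrable[OF \<theta>])
    let ?F = "\<lambda>y. \<theta> y * G (l *\<^sub>R a - l *\<^sub>R y) - \<theta> y * G (l1 *\<^sub>R a - l1 *\<^sub>R y) + \<theta> y * ?c"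
    have iF: "integrable lborel ?F" using i1 i2 i3 by simp
    have eq: "(LINT y|lborel. ?F y)
      = tconv G (on_torus (rescale l \<theta>)) (l *\<^sub>R a) - tconv G (on_torus (rescale l1 \<theta>)) (l1 *\<^sub>R a) + ?c"
      unfolding P(2)[OF l01(1)] P(2)[OF l01(2)]
      using i1 i2 i3 radial_mollifierD(3)[OF \<theta>] by simp
    have "AE y in lborel. \<bar>?F y\<bar> \<le> \<theta> y * (2 * H)"
      using AE_vec_nth_neq[of 1 "a$1"]
    proof eventually_elim
      case (elim y)
      show ?case
      proof (cases "\<theta> y = 0")
        case False
        then have "\<bar>y$i\<bar> \<le> r" for i using supported_in_squareD[OF r(3)] not_le by blast
        then have "y \<in> cell" unfolding cell_iff using r(2) by (meson less_imp_le order_trans)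
        then have z: "norm (a - y) \<le> 2"
          using norm_triangle_ineq4[of a y] norm_le_1_on_cell[OF a] norm_le_1_on_cell[of y] by linarith
        have nz: "a - y \<noteq> 0" using elim by auto
        have scale: "G (m *\<^sub>R a - m *\<^sub>R y) = h (m *\<^sub>R (a - y)) - (ln m + ln (norm (a - y))) / (2 * pi)
            \<and> \<bar>h (m *\<^sub>R (a - y))\<bar> \<le> H" if m: "0 < m" "m \<le> l1" for m
        proof -
          have "norm (m *\<^sub>R (a - y)) = m * norm (a - y)" using m by simp
          also have "\<dots> \<le> l1 * 2" using m z by (intro mult_mono) auto
          finally have n: "norm (m *\<^sub>R (a - y)) \<le> R / 2" using l1 by linarith
          then have "m *\<^sub>R (a - y) \<in> ball 0 R - {0}" using m nz R by auto
          with Gh have "G (m *\<^sub>R (a - y)) + ln (norm (m *\<^sub>R (a - y))) / (2 * pi) = h (m *\<^sub>R (a - y))" by blast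
          moreover have "ln (norm (m *\<^sub>R (a - y))) = ln m + ln (norm (a - y))"
            using m nz by (simp add: ln_mult_pos)
          ultimately have "G (m *\<^sub>R a - m *\<^sub>R y) = h (m *\<^sub>R (a - y)) - (ln m + ln (norm (a - y))) / (2 * pi)"
            by (simp only: scaleR_diff_right)
          moreover have "\<bar>h (m *\<^sub>R (a - y))\<bar> \<le> H" using n by (intro H) simp
          ultimately show ?thesis by blast
        qed
        have "G (l *\<^sub>R a - l *\<^sub>R y) - G (l1 *\<^sub>R a - l1 *\<^sub>R y) + ?c
            = h (l *\<^sub>R (a - y)) - h (l1 *\<^sub>R (a - y))"
          using scale[OF l] scale[of l1] l1 unfolding diff_divide_distrib add_divide_distrib by linarith
        moreover have "?F y = \<theta> y * (G (l *\<^sub>R a - l *\<^sub>R y) - G (l1 *\<^sub>R a - l1 *\<^sub>R y) + ?c)"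
          by (simp only: distrib_left right_diff_distrib)
        ultimately have "?F y = \<theta> y * (h (l *\<^sub>R (a - y)) - h (l1 *\<^sub>R (a - y)))" by (simp only:)
        moreover have "\<bar>h (l *\<^sub>R (a - y)) - h (l1 *\<^sub>R (a - y))\<bar> \<le> 2 * H"
          using scale[OF l] scale[of l1] l1 by linarith
        ultimately show ?thesis
          using radial_mollifierD(2)[OF \<theta>, of y] by (simp add: abs_mult mult_left_mono)
      qed simp
    qed
    moreover have "integrable lborel (\<lambda>y. \<theta> y * (2 * H))" using i3 by simp
    ultimately have "(LINT y|lborel. \<bar>?F y\<bar>) \<le> (LINT y|lborel. \<theta> y * (2 * H))"
      by (intro integral_mono_AE integrable_abs[OF iF])
    also have "\<dots> = 2 * H" using radial_mollifierD(3)[OF \<theta>] by simp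
    finally show ?thesis unfolding eq[symmetric] using integral_abs_bound[of lborel ?F] by linarith
  qed
  then show ?thesis using that[OF l1(1,2)] by blast
qed

lemma average_abs_le:
  assumes f: "isotropic_density f" "\<And>x. f x \<ge> 0" and w: "continuous_on UNIV w"
    and b: "\<And>x. x \<in> cell \<Longrightarrow> f x \<noteq> 0 \<Longrightarrow> \<bar>w x\<bar> \<le> (C::real)"
  shows "\<bar>torus_integral (\<lambda>x. w x * f x)\<bar> \<le> C"
proof -
  note f' = isotropic_densityD[OF f(1)]
  note cf = smooth_on_continuous[OF f'(1)]
  have p: "w x * f x \<le> C * f x" "- C * f x \<le> w x * f x" if "x \<in> cell" for x
  proof -
    have "\<bar>w x * f x\<bar> \<le> C * f x"
      using b[OF that] f(2)[of x] by (cases "f x = 0") (simp_all add: abs_mult mult_right_mono)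
    then show "w x * f x \<le> C * f x" "- C * f x \<le> w x * f x" by linarith+
  qed
  have m: "torus_integral (\<lambda>x. c * f x) = c" for c
    unfolding set_integral_mult_right f'(5) by simp
  have "torus_integral (\<lambda>x. w x * f x) \<le> torus_integral (\<lambda>x. C * f x)"
    by (intro torus_integral_mono continuous_torus_integrable continuous_intros w cf p)
  moreover have "torus_integral (\<lambda>x. - C * f x) \<le> torus_integral (\<lambda>x. w x * f x)"
    by (intro torus_integral_mono continuous_torus_integrable continuous_intros w cf p)
  ultimately show ?thesis unfolding m by linarith
qed

lemma on_torus_rescale_nonneg:
  assumes "radial_mollifier \<theta>"
  shows "on_torus (rescale l \<theta>) x \<ge> 0"
  unfolding on_torus_def rescale_def
  by (intro mult_nonneg_nonneg radial_mollifierD(2)[OF assms]) simp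

abbreviation energy ::
  "(real^2 \<Rightarrow> real) \<Rightarrow> (real^2 \<Rightarrow> real) \<Rightarrow> (real^2 \<Rightarrow> real) \<Rightarrow> real \<Rightarrow> real" where
  "energy G chi \<theta> l \<equiv> interaction G (on_torus (rescale l chi)) (on_torus (rescale l \<theta>))"

text \<open>At a fixed reference scale the potential is continuous and periodic, hence bounded.
  Comparison with it shows that the potential of \<open>chi\<close> at scale \<open>l\<close> is \<open>- ln l / (2 \<pi>)\<close> up to a bounded
  error on the square that contains the support of \<open>\<theta>\<close> at the same scale.\<close>

lemma energy_logarithmic:
  assumes G: "green_function G" and chi: "radial_mollifier chi" and \<theta>: "radial_mollifier \<theta>"
  shows "\<exists>C. \<forall>\<^sub>F l in at_right 0. \<bar>energy G chi \<theta> l + ln l / (2 * pi)\<bar> \<le> C"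
proof -
  obtain l1 H where l1: "0 < l1" "l1 < 1" and H: "\<forall>l a. 0 < l \<longrightarrow> l \<le> l1 \<longrightarrow> a \<in> cell \<longrightarrow>
      \<bar>tconv G (on_torus (rescale l chi)) (l *\<^sub>R a) - tconv G (on_torus (rescale l1 chi)) (l1 *\<^sub>R a)
        + (ln l - ln l1) / (2 * pi)\<bar> \<le> 2 * H"
    by (rule potential_compare_scales[OF G chi])
  obtain r where r: "0 \<le> r" "r < 1/2" "supported_in_square r \<theta>"
    by (rule radial_mollifier_supported[OF \<theta>])
  have pot: "periodic (tconv G (on_torus (rescale l chi)))"
    "continuous_on UNIV (tconv G (on_torus (rescale l chi)))" if "l \<in> {0<..<1}" for l
    using green_potential(2,3)[OF G isotropic_densityD(1,2)[OF isotropic_density_rescale[OF chi that]]]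
    by (auto intro: smooth_on_continuous)
  obtain B where B: "\<And>x. norm (tconv G (on_torus (rescale l1 chi)) x) \<le> B"
    using periodic_bounded[OF pot, of l1] l1 by auto
  let ?C = "2 * H + B + \<bar>ln l1 / (2 * pi)\<bar>"
  have "\<bar>energy G chi \<theta> l + ln l / (2 * pi)\<bar> \<le> ?C" if l: "0 < l" "l < l1" for l
  proof -
    have l': "l \<in> {0<..<1}" using l l1 by simp
    let ?p = "tconv G (on_torus (rescale l chi))" and ?f = "on_torus (rescale l \<theta>)"
    have f: "isotropic_density ?f" by (rule isotropic_density_rescale[OF \<theta> l'])
    note f' = isotropic_densityD[OF f]
    have "\<bar>torus_integral (\<lambda>x. (?p x + ln l / (2 * pi)) * ?f x)\<bar> \<le> ?C"
    proof (rule average_abs_le[OF f on_torus_rescale_nonneg[OF \<theta>]])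
      show "continuous_on UNIV (\<lambda>x. ?p x + ln l / (2 * pi))"
        by (intro continuous_intros pot l')
      fix x :: "real^2" assume x: "x \<in> cell" and nz: "?f x \<noteq> 0"
      have s: "supported_in_square (l * r) (rescale l \<theta>)" using rescale_supported[OF r(3) l(1)] .
      have "rescale l \<theta> x \<noteq> 0"
        using nz on_torus_eq_on_cell[OF s mollifier_supp_scale[OF r(1,2) l'] x] by simp
      then have xi: "\<bar>x$i\<bar> \<le> l * r" for i using supported_in_squareD[OF s] not_le by blast
      define a where "a = inverse l *\<^sub>R x"
      have xa: "x = l *\<^sub>R a" using l by (simp add: a_def)
      have "\<bar>a$i\<bar> \<le> 1/2" for i
      proof -
        have "l * \<bar>a$i\<bar> \<le> l * r" using xi[of i] l by (simp add: xa abs_mult)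
        then have "\<bar>a$i\<bar> \<le> r" using l by simp
        then show ?thesis using r(2) by linarith
      qed
      then have "a \<in> cell" unfolding cell_iff by blast
      with H l have "\<bar>?p x - tconv G (on_torus (rescale l1 chi)) (l1 *\<^sub>R a) + (ln l - ln l1) / (2 * pi)\<bar> \<le> 2 * H"
        unfolding xa by simp
      moreover have "\<bar>tconv G (on_torus (rescale l1 chi)) (l1 *\<^sub>R a)\<bar> \<le> B"
        using B[of "l1 *\<^sub>R a"] by simp
      ultimately show "\<bar>?p x + ln l / (2 * pi)\<bar> \<le> ?C"
        unfolding diff_divide_distrib by linarith
    qed
    moreover have "torus_integral (\<lambda>x. (?p x + ln l / (2 * pi)) * ?f x) = energy G chi \<theta> l + ln l / (2 * pi)"
    proof -
      have "torus_integral (\<lambda>x. (?p x + ln l / (2 * pi)) * ?f x)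
          = torus_integral (\<lambda>x. ?p x * ?f x) + torus_integral (\<lambda>x. ln l / (2 * pi) * ?f x)"
        unfolding distrib_right
        by (intro set_integral_add(2) continuous_torus_integrable continuous_intros pot l'
            smooth_on_continuous[OF f'(1)])
      also have "torus_integral (\<lambda>x. ln l / (2 * pi) * ?f x) = ln l / (2 * pi)"
        unfolding set_integral_mult_right f'(5) by simp
      finally show ?thesis by (simp only: interaction_def)
    qed
    ultimately show ?thesis by simp
  qed
  then show ?thesis
    using l1 by (intro exI[of _ ?C]) (auto simp: eventually_at_right_field intro!: exI[of _ l1])
qed

text \<open>For \<open>l \<ge> \<delta>\<close> the rescaled densities have a common bound, and \<open>G\<close> is integrable.\<close>

lemma energy_bounded_away_from_0:
  assumes G: "green_function G" and chi: "radial_mollifier chi" and \<theta>: "radial_mollifier \<theta>"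
    and \<delta>: "\<delta> > 0"
  obtains C where "\<And>l. \<delta> \<le> l \<Longrightarrow> l < 1 \<Longrightarrow> \<bar>energy G chi \<theta> l\<bar> \<le> C"
proof -
  obtain r where r: "0 \<le> r" "r < 1/2" "supported_in_square r chi"
    by (rule radial_mollifier_supported[OF chi])
  have "compact (chi ` cell)"
    by (intro compact_continuous_image continuous_on_subset[OF smooth_on_continuous[OF radial_mollifierD(1)[OF chi]]]) auto
  then obtain B where B: "\<And>x. x \<in> cell \<Longrightarrow> \<bar>chi x\<bar> \<le> B"
    by (metis compact_imp_bounded bounded_iff imageI real_norm_def)
  have B0: "B \<ge> 0" using B[of 0] by (simp add: cell_iff)
  have Bx: "\<bar>chi x\<bar> \<le> B" for x
  proof (cases "x \<in> cell")
    case False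
    then obtain i where "1/2 < \<bar>x$i\<bar>" unfolding cell_iff by (auto simp: not_le)
    then have "chi x = 0" using r(2) by (intro supported_in_squareD[OF r(3), where i = i]) linarith
    then show ?thesis using B0 by simp
  qed (rule B)
  note G' = green_functionD[OF G]
  let ?C = "torus_integral (\<lambda>x. \<bar>G x\<bar>) * (inverse (\<delta>\<^sup>2) * B)"
  have "\<bar>energy G chi \<theta> l\<bar> \<le> ?C" if l: "\<delta> \<le> l" "l < 1" for l
  proof -
    have l': "l \<in> {0<..<1}" using l \<delta> by simp
    let ?g = "on_torus (rescale l chi)"
    note g' = isotropic_densityD[OF isotropic_density_rescale[OF chi l']]
    note pot = green_potential[OF G g'(1,2)]
    have gb: "norm (?g x) \<le> inverse (\<delta>\<^sup>2) * B" for x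
    proof -
      have "inverse (l\<^sup>2) \<le> inverse (\<delta>\<^sup>2)" using l \<delta> by (intro le_imp_inverse_le power_mono) auto
      then show ?thesis unfolding on_torus_def rescale_def
        using Bx by (simp add: abs_mult mult_mono)
    qed
    have "\<bar>tconv G ?g a\<bar> \<le> ?C" for a
    proof -
      have "norm (torus_integral (\<lambda>x. G x *\<^sub>R ?g (a - x))) \<le> ?C"
        by (rule set_integrable_bounded_scaleR(2)[OF G'(2) continuous_reflect[OF smooth_on_continuous[OF g'(1)]] gb])
      then show ?thesis unfolding pot(1) tconv_def by simp
    qed
    then show ?thesis unfolding interaction_def
      by (intro average_abs_le[OF isotropic_density_rescale[OF \<theta> l'] on_torus_rescale_nonneg[OF \<theta>]]
          smooth_on_continuous pot(3))
  qed
  then show ?thesis using that by blast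
qed

text \<open>The energy is the Dirichlet integral of \<open>\<phi> = G * f\<close>, which can only be small if \<open>\<phi>\<close> pairs
  weakly with every fixed \<open>v\<close>. A bump \<open>v\<close> of unit mass placed around the corner of the cell does
  not meet the support of \<open>\<theta>\<close> at any scale \<open>l < 1\<close>, so by Poisson's equation its pairing with
  \<open>\<phi>\<close> is \<open>-1\<close> for all \<open>l\<close> at once.\<close>

lemma energy_bounded_below:
  assumes G: "green_function G" and \<theta>: "radial_mollifier \<theta>"
  obtains c where "c > 0" "\<And>l. l \<in> {0<..<1} \<Longrightarrow> c \<le> energy G \<theta> \<theta> l"
proof -
  obtain r where r: "0 \<le> r" "r < 1/2" "supported_in_square r \<theta>"
    by (rule radial_mollifier_supported[OF \<theta>])
  \<comment> \<open>The bump has half-width \<open>\<epsilon> r < 1/2 - r\<close>, the gap between the support of \<open>\<theta>\<close> and the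
    boundary of the cell.\<close>
  define \<epsilon> where "\<epsilon> = 1/2 - r"
  have \<epsilon>: "\<epsilon> > 0" "\<epsilon> \<in> {0<..<1}" using r by (auto simp: \<epsilon>_def)
  have "\<epsilon> * r < \<epsilon> * 1" using r \<epsilon> by (intro mult_strict_left_mono) auto
  then have \<epsilon>r: "\<epsilon> * r < 1/2 - r" by (simp add: \<epsilon>_def)
  let ?h = "on_torus (rescale \<epsilon> \<theta>)"
  note h = isotropic_densityD[OF isotropic_density_rescale[OF \<theta> \<epsilon>(2)]]
  note s\<epsilon> = rescale_supported[OF r(3) \<epsilon>(1)]
  define v where "v = (\<lambda>x. 1 *\<^sub>R ?h (- vec (1/2) + 1 *\<^sub>R x))"
  have v': "v x = ?h (x + - vec (1/2))" for x by (simp add: v_def)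
  have sv: "smooth_on UNIV v" unfolding v_def by (rule smooth_on_affine[OF h(1)])
  have pv: "periodic v" unfolding v' [abs_def] by (rule periodic_translate[OF h(2)])
  have mv: "torus_integral v = 1"
    unfolding v'[abs_def] torus_shift(2)[OF h(2) continuous_torus_integrable[OF smooth_on_continuous[OF h(1)]]]
    by (rule h(5))
  have v0: "v x = 0" if "\<And>i. \<bar>x$i\<bar> \<le> r" for x
  proof -
    let ?y = "x + - vec (1/2)"
    have y: "\<epsilon> * r < \<bar>?y$i\<bar>" "\<bar>?y$i\<bar> < 1 - \<epsilon> * r" for i
    proof -
      have "?y$i = x$i - 1/2" by simp
      then show "\<epsilon> * r < \<bar>?y$i\<bar>" "\<bar>?y$i\<bar> < 1 - \<epsilon> * r" using that[of i] \<epsilon>r by linarith+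
    qed
    have "\<epsilon> * r < 1/2" using \<epsilon>r r(1) by linarith
    from on_torus_eq_near_cell[OF s\<epsilon> this y(2)] supported_in_squareD[OF s\<epsilon> y(1)]
    show ?thesis unfolding v' by simp
  qed
  define D where "D = torus_integral (\<lambda>x. pderiv_dir 1 v x * pderiv_dir 1 v x + pderiv_dir 2 v x * pderiv_dir 2 v x)"
  have D0: "D \<ge> 0" unfolding D_def by (simp add: set_lebesgue_integral_def)
  \<comment> \<open>The Dirichlet integral of \<open>\<phi> + t v\<close> is the energy minus \<open>2 t\<close> plus \<open>t\<^sup>2 D\<close>. The minimum over
    \<open>t\<close> is at \<open>1 / D\<close>; the value below also makes sense without knowing \<open>D \<noteq> 0\<close>.\<close>
  define t where "t = 1 / (D + 1)"
  have t: "t > 0" "t * D \<le> 1" using D0 by (auto simp: t_def)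
  have "t \<le> energy G \<theta> \<theta> l" if l: "l \<in> {0<..<1}" for l
  proof -
    let ?f = "on_torus (rescale l \<theta>)"
    have l0: "l > 0" using l by simp
    note s = rescale_supported[OF r(3) l0]
    note f = isotropic_densityD[OF isotropic_density_rescale[OF \<theta> l]]
    define \<phi> where "\<phi> = tconv G ?f"
    note \<phi> = green_potential[OF G f(1,2), folded \<phi>_def]
    note pair = dirichlet_pairing[OF G f(1,2,5), folded \<phi>_def]
    have fv: "?f x * v x = 0" if "x \<in> cell" for x
    proof (cases "?f x = 0")
      case False
      then have "rescale l \<theta> x \<noteq> 0"
        using on_torus_eq_on_cell[OF s mollifier_supp_scale[OF r(1,2) l] that] by simp
      then have "\<bar>x$i\<bar> \<le> l * r" for i using supported_in_squareD[OF s] not_le by blast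
      moreover have "l * r \<le> 1 * r" using l r by (intro mult_right_mono) auto
      ultimately have "\<bar>x$i\<bar> \<le> r" for i by (metis mult_1 order_trans)
      then show ?thesis using v0 by simp
    qed simp
    have "torus_integral (\<lambda>x. ?f x * v x) = 0"
      unfolding set_lebesgue_integral_def
      by (rule integral_eq_zero_AE) (use fv in \<open>auto simp: indicator_def intro!: AE_I2\<close>)
    then have cross: "torus_integral (\<lambda>x. pderiv_dir 1 \<phi> x * pderiv_dir 1 v x + pderiv_dir 2 \<phi> x * pderiv_dir 2 v x) = -1"
      unfolding pair[OF sv pv] mv by simp
    have self: "torus_integral (\<lambda>x. pderiv_dir 1 \<phi> x * pderiv_dir 1 \<phi> x + pderiv_dir 2 \<phi> x * pderiv_dir 2 \<phi> x) = energy G \<theta> \<theta> l"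
      unfolding pair[OF \<phi>(3,2)] \<phi>(4) interaction_def \<phi>_def[symmetric] by (simp add: mult.commute)
    note c = smooth_on_continuous[OF smooth_on_pderiv_dir[OF \<phi>(3)]] smooth_on_continuous[OF smooth_on_pderiv_dir[OF sv]]
    have "0 \<le> torus_integral (\<lambda>x. (pderiv_dir 1 \<phi> x + t * pderiv_dir 1 v x)^2 + (pderiv_dir 2 \<phi> x + t * pderiv_dir 2 v x)^2)"
      by (simp add: set_lebesgue_integral_def)
    also have "\<dots> = torus_integral (\<lambda>x. ((pderiv_dir 1 \<phi> x * pderiv_dir 1 \<phi> x + pderiv_dir 2 \<phi> x * pderiv_dir 2 \<phi> x)
        + 2 * t * (pderiv_dir 1 \<phi> x * pderiv_dir 1 v x + pderiv_dir 2 \<phi> x * pderiv_dir 2 v x))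
        + t^2 * (pderiv_dir 1 v x * pderiv_dir 1 v x + pderiv_dir 2 v x * pderiv_dir 2 v x))"
      by (simp add: power2_eq_square algebra_simps)
    also have "\<dots> = torus_integral (\<lambda>x. (pderiv_dir 1 \<phi> x * pderiv_dir 1 \<phi> x + pderiv_dir 2 \<phi> x * pderiv_dir 2 \<phi> x)
        + 2 * t * (pderiv_dir 1 \<phi> x * pderiv_dir 1 v x + pderiv_dir 2 \<phi> x * pderiv_dir 2 v x))
        + torus_integral (\<lambda>x. t^2 * (pderiv_dir 1 v x * pderiv_dir 1 v x + pderiv_dir 2 v x * pderiv_dir 2 v x))"
      by (intro set_integral_add(2) continuous_torus_integrable continuous_intros c)
    also have "\<dots> = torus_integral (\<lambda>x. pderiv_dir 1 \<phi> x * pderiv_dir 1 \<phi> x + pderiv_dir 2 \<phi> x * pderiv_dir 2 \<phi> x)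
        + torus_integral (\<lambda>x. 2 * t * (pderiv_dir 1 \<phi> x * pderiv_dir 1 v x + pderiv_dir 2 \<phi> x * pderiv_dir 2 v x))
        + torus_integral (\<lambda>x. t^2 * (pderiv_dir 1 v x * pderiv_dir 1 v x + pderiv_dir 2 v x * pderiv_dir 2 v x))"
      by (intro arg_cong2[of _ _ _ _ "(+)"] refl set_integral_add(2) continuous_torus_integrable continuous_intros c)
    also have "\<dots> = energy G \<theta> \<theta> l + 2 * t * (-1) + t^2 * D"
      unfolding set_integral_mult_right self cross D_def ..
    finally have "2 * t - t * (t * D) \<le> energy G \<theta> \<theta> l" by (simp add: power2_eq_square)
    moreover have "t * (t * D) \<le> t * 1" using t by (intro mult_left_mono) auto
    ultimately show ?thesis by linarith
  qed
  then show ?thesis using that t(1) by blast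
qed

section \<open>Covariances and the scaling limit\<close>

lemma torus_integral_vec_nth:
  fixes F :: "real^2 \<Rightarrow> real^2"
  assumes "set_integrable lborel cell F"
  shows "torus_integral F $ i = torus_integral (\<lambda>x. F x $ i)"
  using integral_bounded_linear[OF bounded_linear_vec_nth assms[unfolded set_integrable_def], of i]
  by (simp add: set_lebesgue_integral_def)

lemma Gamma_coeff_energy:
  assumes G: "green_function G" and K: "biot_savart_kernel K" and \<theta>: "radial_mollifier \<theta>"
    and l: "l \<in> {0<..<1}"
  shows "Gamma_coeff K \<theta> \<kappa> l = 2 * sqrt \<kappa> / sqrt (energy G \<theta> \<theta> l)"
  unfolding Gamma_coeff_def
    torus_L2norm_biot_savart[OF G K isotropic_density_rescale[OF \<theta> l]] by (simp add: divide_inverse)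

lemma sigma_3_smooth:
  assumes G: "green_function G" and chi: "radial_mollifier chi" and l: "l \<in> {0<..<1}"
  shows "smooth_on UNIV (sigma_3 G chi \<gamma> l)" "periodic (sigma_3 G chi \<gamma> l)"
proof -
  note g = isotropic_densityD[OF isotropic_density_rescale[OF chi l]]
  note \<psi> = green_potential[OF G g(1,2)]
  have eq: "sigma_3 G chi \<gamma> l = (\<lambda>x. \<gamma> l *\<^sub>R tconv G (on_torus (rescale l chi)) (0 + 1 *\<^sub>R x))"
    by (simp add: sigma_3_def[abs_def])
  show "smooth_on UNIV (sigma_3 G chi \<gamma> l)" unfolding eq by (rule smooth_on_affine[OF \<psi>(3)])
  show "periodic (sigma_3 G chi \<gamma> l)"
    using \<psi>(2) by (simp add: periodic_def sigma_3_def)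
qed

lemma hessian_Q_3_energy:
  assumes G: "green_function G" and chi: "radial_mollifier chi" and l: "l \<in> {0<..<1}"
  shows "hessian (Q_3 G chi \<gamma> l) 0 = (- ((\<gamma> l)\<^sup>2 * energy G chi chi l / 2)) *\<^sub>R mat 1"
proof -
  note d = isotropic_density_rescale[OF chi l]
  note g = isotropic_densityD[OF d]
  define \<psi> where "\<psi> = tconv G (on_torus (rescale l chi))"
  note \<psi> = green_potential[OF G g(1,2), folded \<psi>_def]
  let ?s = "sigma_3 G chi \<gamma> l"
  have s: "?s = (\<lambda>x. \<gamma> l *\<^sub>R \<psi> x)" by (simp add: sigma_3_def[abs_def] \<psi>_def)
  note sm = sigma_3_smooth[OF G chi l, of \<gamma>]
  have C1: "Ck_on 1 UNIV ?s" "Ck_on 1 UNIV (pderiv_dir j ?s)" for j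
    using Ck_on_2D[OF Ck_on_2_smooth[OF sm(1)]] by blast+
  note int = continuous_torus_integrable[OF smooth_on_continuous[OF sm(1)]]
  have p: "periodic (pderiv_dir j ?s)" for j
    by (rule periodic_pderiv_dir[OF sm(2) smooth_on_differentiable[OF sm(1)]])
  have ds: "pderiv_dir i (pderiv_dir j ?s) = (\<lambda>x. \<gamma> l *\<^sub>R pderiv_dir i (pderiv_dir j \<psi>) x)" for i j
    unfolding s pderiv_dir_scaleR[OF smooth_on_differentiable[OF \<psi>(3)]]
    by (rule pderiv_dir_scaleR[OF smooth_on_differentiable[OF smooth_on_pderiv_dir[OF \<psi>(3)]]])
  have "pderiv_dir i (pderiv_dir j (Q_3 G chi \<gamma> l)) 0
      = (- ((\<gamma> l)\<^sup>2 * energy G chi chi l / 2)) * (if i = j then 1 else 0)" for i j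
  proof -
    have "pderiv_dir i (pderiv_dir j (Q_3 G chi \<gamma> l)) 0 = tconv (pderiv_dir i (pderiv_dir j ?s)) ?s 0"
      unfolding Q_3_def pderiv_dir_tconv[OF sm(2) C1(1) int] pderiv_dir_tconv[OF p C1(2) int] ..
    also have "\<dots> = torus_integral (\<lambda>x. (\<gamma> l)\<^sup>2 * (\<psi> x * pderiv_dir i (pderiv_dir j \<psi>) (- x)))"
      unfolding tconv_def ds by (simp add: s power2_eq_square ac_simps)
    also have "\<dots> = (\<gamma> l)\<^sup>2 * torus_integral (\<lambda>x. \<psi> x * pderiv_dir i (pderiv_dir j \<psi>) (- x))"
      by (rule set_integral_mult_right)
    also have "torus_integral (\<lambda>x. \<psi> x * pderiv_dir i (pderiv_dir j \<psi>) (- x))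
      = (if i = j then - energy G chi chi l / 2 else 0)"
      unfolding \<psi>_def by (rule second_moments_of_potential[OF G d d])
    finally show ?thesis by simp
  qed
  then show ?thesis
    unfolding hessian_def by (simp add: vec_eq_iff mat_def)
qed

text \<open>With \<open>K * f = (- \<partial>\<^sub>2 \<phi>, \<partial>\<^sub>1 \<phi>)\<close> the entries of the Jacobian are second moments of the
  potential \<open>\<phi>\<close>. The rotation of the gradient turns the scalar moment matrix into a multiple of
  the rotation matrix.\<close>

lemma jacobian_Q_H3_energy:
  assumes G: "green_function G" and K: "biot_savart_kernel K"
    and \<theta>: "radial_mollifier \<theta>" and chi: "radial_mollifier chi" and l: "l \<in> {0<..<1}"
  shows "jacobian (Q_H3 G K \<theta> chi \<kappa> \<gamma> l) (at 0)
    = (Gamma_coeff K \<theta> \<kappa> l * \<gamma> l * energy G chi \<theta> l / 2) *\<^sub>R vector [vector [0, 1], vector [- 1, 0]]"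
proof -
  note df = isotropic_density_rescale[OF \<theta> l] and dg = isotropic_density_rescale[OF chi l]
  note f = isotropic_densityD[OF df] and g = isotropic_densityD[OF dg]
  define \<psi> where "\<psi> = tconv G (on_torus (rescale l chi))"
  define \<phi> where "\<phi> = tconv G (on_torus (rescale l \<theta>))"
  define u where "u = tconv K (on_torus (rescale l \<theta>))"
  define \<Gamma> where "\<Gamma> = Gamma_coeff K \<theta> \<kappa> l"
  note \<psi> = green_potential[OF G g(1,2), folded \<psi>_def]
  note \<phi> = green_potential[OF G f(1,2), folded \<phi>_def]
  have u\<phi>: "u x = vector [- pderiv_dir 2 \<phi> x, pderiv_dir 1 \<phi> x]" for x
    unfolding u_def \<phi>_def by (rule biot_savart_eq_rotated_gradient[OF G K f(1,2)])
  have u12: "(\<lambda>x. u x $ 1) = (\<lambda>x. - pderiv_dir 2 \<phi> x)" "(\<lambda>x. u x $ 2) = pderiv_dir 1 \<phi>"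
    by (simp_all add: u\<phi> vector_2)
  have su: "smooth_on UNIV u"
    using K[unfolded biot_savart_kernel_def, THEN conjunct2, THEN conjunct2, THEN spec[of _ "on_torus (rescale l \<theta>)"]] f(1,2)
    unfolding u_def by blast
  have p\<phi>: "periodic (pderiv_dir i \<phi>)" for i
    by (rule periodic_pderiv_dir[OF \<phi>(2) smooth_on_differentiable[OF \<phi>(3)]])
  let ?H = "sigma_H K \<theta> \<kappa> l" and ?s = "sigma_3 G chi \<gamma> l"
  have H: "?H = (\<lambda>x. \<Gamma> *\<^sub>R u x)" by (simp add: sigma_H_def[abs_def] u_def \<Gamma>_def)
  have H': "?H = (\<lambda>x. \<Gamma> *\<^sub>R u (0 + 1 *\<^sub>R x))" by (simp add: H)
  have sH: "smooth_on UNIV ?H" unfolding H' by (rule smooth_on_affine[OF su])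
  have pH: "periodic ?H"
    unfolding H u\<phi> using p\<phi> unfolding periodic_def by simp
  have C1: "Ck_on 1 UNIV ?H" by (rule Ck_on_2D(1)[OF Ck_on_2_smooth[OF sH]])
  note sm = sigma_3_smooth[OF G chi l, of \<gamma>]
  note int = continuous_torus_integrable[OF smooth_on_continuous[OF sm(1)]]
  have p: "periodic (pderiv_dir j ?H)" for j
    by (rule periodic_pderiv_dir[OF pH smooth_on_differentiable[OF sH]])
  have dphi: "pderiv_dir i \<phi> differentiable (at x)" for i x
    by (rule smooth_on_differentiable[OF smooth_on_pderiv_dir[OF \<phi>(3)]])
  have entry: "pderiv_dir j (Q_H3 G K \<theta> chi \<kappa> \<gamma> l) 0 $ i
      = \<Gamma> * \<gamma> l * torus_integral (\<lambda>x. \<psi> x * pderiv_dir j (\<lambda>y. u y $ i) (- x))" for i j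
  proof -
    have "pderiv_dir j (Q_H3 G K \<theta> chi \<kappa> \<gamma> l) 0 $ i
      = torus_integral (\<lambda>x. ?s x *\<^sub>R pderiv_dir j ?H (0 - x)) $ i"
      unfolding Q_H3_def pderiv_dir_tconv[OF pH C1 int] tconv_def ..
    also have "\<dots> = torus_integral (\<lambda>x. (?s x *\<^sub>R pderiv_dir j ?H (0 - x)) $ i)"
      by (rule torus_integral_vec_nth[OF tconv_integrable[OF p smooth_on_continuous[OF smooth_on_pderiv_dir[OF sH]] int]])
    also have "\<dots> = torus_integral (\<lambda>x. \<Gamma> * \<gamma> l * (\<psi> x * pderiv_dir j (\<lambda>y. u y $ i) (- x)))"
      unfolding H pderiv_dir_scaleR[OF smooth_on_differentiable[OF su]]
        pderiv_dir_vec_nth[OF smooth_on_differentiable[OF su]]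
      by (simp add: sigma_3_def \<psi>_def ac_simps)
    also have "\<dots> = \<Gamma> * \<gamma> l * torus_integral (\<lambda>x. \<psi> x * pderiv_dir j (\<lambda>y. u y $ i) (- x))"
      by (rule set_integral_mult_right)
    finally show ?thesis .
  qed
  note mom = second_moments_of_potential[OF G df dg, folded \<phi>_def \<psi>_def]
  have neg: "torus_integral (\<lambda>x. \<psi> x * - pderiv_dir j (pderiv_dir 2 \<phi>) (- x))
      = - torus_integral (\<lambda>x. \<psi> x * pderiv_dir j (pderiv_dir 2 \<phi>) (- x))" for j
    by (simp add: set_lebesgue_integral_def)
  let ?E = "energy G chi \<theta> l"
  have e1: "pderiv_dir 1 (Q_H3 G K \<theta> chi \<kappa> \<gamma> l) 0 $ 1 = 0"
    "pderiv_dir 2 (Q_H3 G K \<theta> chi \<kappa> \<gamma> l) 0 $ 1 = \<Gamma> * \<gamma> l * ?E / 2"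
    unfolding entry u12 pderiv_dir_minus[OF dphi] neg mom by simp_all
  have e2: "pderiv_dir 1 (Q_H3 G K \<theta> chi \<kappa> \<gamma> l) 0 $ 2 = - (\<Gamma> * \<gamma> l * ?E / 2)"
    "pderiv_dir 2 (Q_H3 G K \<theta> chi \<kappa> \<gamma> l) 0 $ 2 = 0"
    unfolding entry u12 mom by simp_all
  show ?thesis
    using e1 e2 unfolding \<Gamma>_def[symmetric]
    by (simp add: vec_eq_iff forall_2 vector_2 jacobian_def matrix_def pderiv_dir_def)
qed

text \<open>Dividing by \<open>L\<close> shows that both functions are asymptotic to \<open>L\<close>.\<close>

lemma tendsto_ratio_of_bounded_difference:
  fixes f g L :: "real \<Rightarrow> real"
  assumes f: "\<forall>\<^sub>F x in F. \<bar>f x - L x\<bar> \<le> C" and g: "\<forall>\<^sub>F x in F. \<bar>g x - L x\<bar> \<le> D"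
    and L: "filterlim L at_top F"
  shows "((\<lambda>x. f x / g x) \<longlongrightarrow> 1) F"
proof -
  have one: "((\<lambda>x. h x / L x) \<longlongrightarrow> 1) F" if h: "\<forall>\<^sub>F x in F. \<bar>h x - L x\<bar> \<le> B" for h B
  proof -
    have "((\<lambda>x. B / L x) \<longlongrightarrow> 0) F" by (rule tendsto_divide_0[OF tendsto_const filterlim_at_top_imp_at_infinity[OF L]])
    moreover have "\<forall>\<^sub>F x in F. norm (h x / L x - 1) \<le> B / L x"
      using h filterlim_at_top_dense[THEN iffD1, OF L, rule_format, of 0]
    proof eventually_elim
      case (elim x)
      then have "h x / L x - 1 = (h x - L x) / L x" by (simp add: field_simps)
      with elim show ?case by (simp add: divide_right_mono)
    qed
    ultimately have "((\<lambda>x. h x / L x - 1) \<longlongrightarrow> 0) F" by (rule Lim_null_comparison[rotated])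
    then show ?thesis by (simp add: LIM_zero_iff)
  qed
  have lim: "((\<lambda>x. (f x / L x) / (g x / L x)) \<longlongrightarrow> 1 / 1) F"
    by (intro tendsto_divide one[OF f] one[OF g]) simp
  have "\<forall>\<^sub>F x in F. (f x / L x) / (g x / L x) = f x / g x"
    using filterlim_at_top_dense[THEN iffD1, OF L, rule_format, of 0]
    by eventually_elim simp
  from Lim_transform_eventually[OF lim this] show ?thesis by simp
qed

lemma energy_ratio_tendsto_1:
  assumes G: "green_function G"
    and a: "radial_mollifier a" and b: "radial_mollifier b" and \<theta>: "radial_mollifier \<theta>"
  shows "((\<lambda>l. energy G a b l / energy G \<theta> \<theta> l) \<longlongrightarrow> 1) (at_right 0)"
proof -
  obtain C where C: "\<forall>\<^sub>F l in at_right 0. \<bar>energy G a b l + ln l / (2 * pi)\<bar> \<le> C"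
    using energy_logarithmic[OF G a b] by blast
  obtain D where D: "\<forall>\<^sub>F l in at_right 0. \<bar>energy G \<theta> \<theta> l + ln l / (2 * pi)\<bar> \<le> D"
    using energy_logarithmic[OF G \<theta> \<theta>] by blast
  have "filterlim (\<lambda>l::real. 1 / (2 * pi) * (- ln l)) at_top (at_right 0)"
  proof (rule filterlim_tendsto_pos_mult_at_top[OF tendsto_const])
    show "filterlim (\<lambda>l::real. - ln l) at_top (at_right 0)"
      using ln_at_0 by (simp add: filterlim_uminus_at_top)
  qed simp
  then have L: "filterlim (\<lambda>l::real. - (ln l / (2 * pi))) at_top (at_right 0)" by simp
  show ?thesis
    by (rule tendsto_ratio_of_bounded_difference[OF _ _ L]) (use C D in simp_all)
qed

text \<open>Since \<open>\<Gamma>\<^sup>2\<close> is \<open>4 \<kappa>\<close> divided by the energy of \<open>\<theta>\<close>, the prefactor \<open>\<Gamma> \<gamma> = (\<gamma> / \<Gamma>) \<Gamma>\<^sup>2\<close> combines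
  with the energy of the Jacobian into a ratio of energies that tends to 1. The limit \<open>q = 0\<close> is
  included.\<close>

lemma jacobian_Q_H3_tendsto:
  assumes G: "green_function G" and K: "biot_savart_kernel K"
    and \<theta>: "radial_mollifier \<theta>" and chi: "radial_mollifier chi" and \<kappa>: "\<kappa> > 0"
    and q: "((\<lambda>l. \<gamma> l / Gamma_coeff K \<theta> \<kappa> l) \<longlongrightarrow> q) (at_right 0)"
  shows "((\<lambda>l. jacobian (Q_H3 G K \<theta> chi \<kappa> \<gamma> l) (at 0)) \<longlongrightarrow>
     (2 * \<kappa> * q) *\<^sub>R vector [vector [0, 1], vector [- 1, 0]]) (at_right 0)"
proof -
  let ?J = "vector [vector [0, 1], vector [- 1, 0]] :: real^2^2"
  obtain c where c: "c > 0" "\<And>l. l \<in> {0<..<1} \<Longrightarrow> c \<le> energy G \<theta> \<theta> l"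
    using energy_bounded_below[OF G \<theta>] by blast
  let ?r = "\<lambda>l. (2 * \<kappa> * (\<gamma> l / Gamma_coeff K \<theta> \<kappa> l) * (energy G chi \<theta> l / energy G \<theta> \<theta> l)) *\<^sub>R ?J"
  have "(?r \<longlongrightarrow> (2 * \<kappa> * q * 1) *\<^sub>R ?J) (at_right 0)"
    by (intro tendsto_intros q energy_ratio_tendsto_1[OF G chi \<theta> \<theta>])
  moreover have "\<forall>\<^sub>F l in at_right 0. ?r l = jacobian (Q_H3 G K \<theta> chi \<kappa> \<gamma> l) (at 0)"
  proof -
    have "?r l = jacobian (Q_H3 G K \<theta> chi \<kappa> \<gamma> l) (at 0)" if l: "0 < l" "l < 1" for l
    proof -
      have l': "l \<in> {0<..<1}" using l by simp
      have E: "energy G \<theta> \<theta> l > 0" using c(1) c(2)[OF l'] by linarith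
      have g: "Gamma_coeff K \<theta> \<kappa> l > 0" "(Gamma_coeff K \<theta> \<kappa> l)\<^sup>2 = 4 * \<kappa> / energy G \<theta> \<theta> l"
        unfolding Gamma_coeff_energy[OF G K \<theta> l'] using E \<kappa>
        by (simp_all add: power_divide power_mult_distrib)
      have "2 * \<kappa> * (\<gamma> l / Gamma_coeff K \<theta> \<kappa> l) * (energy G chi \<theta> l / energy G \<theta> \<theta> l)
        = (Gamma_coeff K \<theta> \<kappa> l)\<^sup>2 * (\<gamma> l / Gamma_coeff K \<theta> \<kappa> l) * energy G chi \<theta> l / 2"
        unfolding g(2) by simp
      also have "\<dots> = Gamma_coeff K \<theta> \<kappa> l * \<gamma> l * energy G chi \<theta> l / 2"
        using g(1) by (simp add: power2_eq_square)
      finally show ?thesis unfolding jacobian_Q_H3_energy[OF G K \<theta> chi l'] by simp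
    qed
    then show ?thesis
      by (auto simp: eventually_at_right_field intro!: exI[of _ 1])
  qed
  ultimately show ?thesis by (simp add: tendsto_cong)
qed

text \<open>The bound on \<open>\<gamma>\<close> reduces the claim to a bound for a ratio of energies on all of
  \<open>(0, 1)\<close>: near 0 it follows from the limit of the ratio, and on the rest of the interval from
  separate bounds for numerator and denominator.\<close>

lemma hessian_Q_3_bounded:
  assumes G: "green_function G" and K: "biot_savart_kernel K"
    and \<theta>: "radial_mollifier \<theta>" and chi: "radial_mollifier chi" and \<kappa>: "\<kappa> > 0"
    and pos: "\<And>l. l \<in> {0<..<1} \<Longrightarrow> \<gamma> l > 0"
    and le: "\<And>l. l \<in> {0<..<1} \<Longrightarrow> \<gamma> l \<le> C * Gamma_coeff K \<theta> \<kappa> l"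
    and N: "is_norm normM"
  shows "bdd_above ((\<lambda>l. normM (hessian (Q_3 G chi \<gamma> l) 0)) ` {0<..<1})"
proof -
  obtain c where c: "c > 0" "\<And>l. l \<in> {0<..<1} \<Longrightarrow> c \<le> energy G \<theta> \<theta> l"
    using energy_bounded_below[OF G \<theta>] by blast
  have "\<forall>\<^sub>F l in at_right 0. \<bar>energy G chi chi l / energy G \<theta> \<theta> l\<bar> < 2"
    by (rule order_tendstoD(2)[OF tendsto_rabs[OF energy_ratio_tendsto_1[OF G chi chi \<theta>]]]) simp
  then obtain \<delta> where \<delta>: "\<delta> > 0" "\<forall>l>0. l < \<delta> \<longrightarrow> \<bar>energy G chi chi l / energy G \<theta> \<theta> l\<bar> < 2"
    unfolding eventually_at_right_field by blast
  obtain B where B: "\<And>l. \<delta> \<le> l \<Longrightarrow> l < 1 \<Longrightarrow> \<bar>energy G chi chi l\<bar> \<le> B"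
    using energy_bounded_away_from_0[OF G chi chi \<delta>(1)] by blast
  have ratio: "\<bar>energy G chi chi l / energy G \<theta> \<theta> l\<bar> \<le> max 2 (B / c)" if l: "l \<in> {0<..<1}" for l
  proof (cases "l < \<delta>")
    case True
    then have "\<bar>energy G chi chi l / energy G \<theta> \<theta> l\<bar> < 2" using \<delta>(2) l by simp
    then show ?thesis by linarith
  next
    case False
    have "\<bar>energy G chi chi l / energy G \<theta> \<theta> l\<bar> = \<bar>energy G chi chi l\<bar> / energy G \<theta> \<theta> l"
      using c(1) c(2)[OF l] by simp
    also have "\<dots> \<le> B / c"
      using B[of l] False l c(1) c(2)[OF l] by (intro frac_le) (auto intro: order_trans[OF abs_ge_zero])
    finally show ?thesis by linarith
  qed
  have norm_scale: "normM (a *\<^sub>R A) = \<bar>a\<bar> * normM A" and norm_nonneg: "normM A \<ge> 0" for a A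
    using N unfolding is_norm_def by blast+
  have "normM (hessian (Q_3 G chi \<gamma> l) 0) \<le> C\<^sup>2 * (2 * \<kappa>) * max 2 (B / c) * normM (mat 1)"
    if l: "l \<in> {0<..<1}" for l
  proof -
    have E: "energy G \<theta> \<theta> l > 0" using c(1) c(2)[OF l] by linarith
    have g: "(Gamma_coeff K \<theta> \<kappa> l)\<^sup>2 = 4 * \<kappa> / energy G \<theta> \<theta> l"
      unfolding Gamma_coeff_energy[OF G K \<theta> l] using E \<kappa>
      by (simp add: power_divide power_mult_distrib)
    have "(\<gamma> l)\<^sup>2 \<le> (C * Gamma_coeff K \<theta> \<kappa> l)\<^sup>2"
      using pos[OF l] le[OF l] by (intro power_mono) auto
    then have "(\<gamma> l)\<^sup>2 \<le> C\<^sup>2 * (4 * \<kappa> / energy G \<theta> \<theta> l)"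
      by (simp only: power_mult_distrib g)
    then have "(\<gamma> l)\<^sup>2 * \<bar>energy G chi chi l\<bar> / 2
      \<le> C\<^sup>2 * (4 * \<kappa> / energy G \<theta> \<theta> l) * \<bar>energy G chi chi l\<bar> / 2"
      by (intro divide_right_mono mult_right_mono) auto
    also have "\<dots> = C\<^sup>2 * (2 * \<kappa>) * \<bar>energy G chi chi l / energy G \<theta> \<theta> l\<bar>"
      using E by simp
    also have "\<dots> \<le> C\<^sup>2 * (2 * \<kappa>) * max 2 (B / c)"
      using ratio[OF l] \<kappa> by (intro mult_left_mono) auto
    finally have "\<bar>- ((\<gamma> l)\<^sup>2 * energy G chi chi l / 2)\<bar> \<le> C\<^sup>2 * (2 * \<kappa>) * max 2 (B / c)"
      by (simp add: abs_mult)
    then show ?thesis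
      unfolding hessian_Q_3_energy[OF G chi l] norm_scale
      by (rule mult_right_mono[OF _ norm_nonneg])
  qed
  then show ?thesis by (rule bdd_aboveI2)
qed

theorem proposition3p6:
  fixes G :: "real^2 \<Rightarrow> real" and K :: "real^2 \<Rightarrow> real^2"
    and \<theta> chi :: "real^2 \<Rightarrow> real" and \<kappa> :: real and \<gamma> :: "real \<Rightarrow> real"
    and normM :: "real^2^2 \<Rightarrow> real"
  assumes "green_function G" and "biot_savart_kernel K"
    and "radial_mollifier \<theta>" and "radial_mollifier chi"
    and "\<kappa> > 0"
    and "\<And>l. l \<in> {0<..<1} \<Longrightarrow> \<gamma> l > 0"
    and "(\<gamma> \<longlongrightarrow> 0) (at_right 0)"
    and "is_norm normM"
  shows
    "(\<gamma> \<in> o[at_right 0](Gamma_coeff K \<theta> \<kappa>) \<longrightarrow>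
        ((\<lambda>l. jacobian (Q_H3 G K \<theta> chi \<kappa> \<gamma> l) (at 0)) \<longlongrightarrow> 0) (at_right 0)) \<and>
     (\<forall>q0. ((\<lambda>l. \<gamma> l / Gamma_coeff K \<theta> \<kappa> l) \<longlongrightarrow> q0) (at_right 0) \<longrightarrow> q0 \<noteq> 0 \<longrightarrow>
        ((\<lambda>l. jacobian (Q_H3 G K \<theta> chi \<kappa> \<gamma> l) (at 0)) \<longlongrightarrow>
           (2 * \<kappa> * q0) *\<^sub>R vector [vector [0, 1], vector [- 1, 0]]) (at_right 0)) \<and>
     ((\<exists>C. \<forall>l\<in>{0<..<1}. \<gamma> l \<le> C * Gamma_coeff K \<theta> \<kappa> l) \<longrightarrow>
        bdd_above ((\<lambda>l. normM (hessian (Q_3 G chi \<gamma> l) 0)) ` {0<..<1}))"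
proof (intro conjI impI allI)
  note lim = jacobian_Q_H3_tendsto[OF assms(1-5)]
  assume "\<gamma> \<in> o[at_right 0](Gamma_coeff K \<theta> \<kappa>)"
  from lim[OF smalloD_tendsto[OF this]]
  show "((\<lambda>l. jacobian (Q_H3 G K \<theta> chi \<kappa> \<gamma> l) (at 0)) \<longlongrightarrow> 0) (at_right 0)" by simp
next
  fix q0
  assume "((\<lambda>l. \<gamma> l / Gamma_coeff K \<theta> \<kappa> l) \<longlongrightarrow> q0) (at_right 0)"
  then show "((\<lambda>l. jacobian (Q_H3 G K \<theta> chi \<kappa> \<gamma> l) (at 0)) \<longlongrightarrow>
      (2 * \<kappa> * q0) *\<^sub>R vector [vector [0, 1], vector [- 1, 0]]) (at_right 0)"
    by (rule jacobian_Q_H3_tendsto[OF assms(1-5)])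
next
  assume "\<exists>C. \<forall>l\<in>{0<..<1}. \<gamma> l \<le> C * Gamma_coeff K \<theta> \<kappa> l"
  then obtain C where "\<forall>l\<in>{0<..<1}. \<gamma> l \<le> C * Gamma_coeff K \<theta> \<kappa> l" by blast
  then show "bdd_above ((\<lambda>l. normM (hessian (Q_3 G chi \<gamma> l) 0)) ` {0<..<1})"
    using assms by (intro hessian_Q_3_bounded[of G K \<theta> chi \<kappa> \<gamma> C]) auto
qed

end
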